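(* For any $\gamma\in E(\mathbb{Z})$, there exist $a_1,\dots,a_k\in R(\mathbb{Z})^+$, with $a_i\neq 0,\pm1$ for $i\neq 1,k$, and a diagonal matrix $\begin{pmatrix}\omega&0\\0&\varpi\end{pmatrix}\in G(\mathbb{Z})$ such that $$\gamma=W(a_1)W(a_2)\cdots W(a_k)\begin{pmatrix}\omega&0\\0&\varpi\end{pmatrix}.$$ Consequently, $\mathcal{W}$ is a finite-index subgroup of $E(\mathbb{Z})$.
   Context: Fix $\dim\in\{3,4,5\}$. If $\dim=3$, $R(\mathbb{Z})$ is the ring of integers of an imaginary quadratic field. If $\dim=4$, $R(\mathbb{Z})$ is a maximal $\ddagger$-order of a rational definite quaternion algebra $\left(\frac{a,b}{\mathbb{Q}}\right)$ with orthogonal involution $(x+yi+zj+tij)^\ddagger=x+yi+zj-tij$ (an order stable under $\ddagger$, maximal among such). If $\dim=5$, $R(\mathbb{Z})$ is a maximal order of a rational definite quaternion algebra. $R(\mathbb{Z})^+$ is the set of $\ddagger$-fixed elements if $\dim=4$ and $R(\mathbb{Z})$ otherwise. $G(\mathbb{Z})=SL(2,R(\mathbb{Z}))$ if $\dim=3,5$ (for quaternions: matrices over $R(\mathbb{Z})$ with determinant $1$ as $4\times4$ complex matrices via an embedding of the Hamilton quaternions in $\mathrm{Mat}(2,\mathbb{C})$), and $G(\mathbb{Z})=\{M\in\mathrm{Mat}(2,R(\mathbb{Z})):\hat\ddagger(M)M=M\hat\ddagger(M)=I\}$ if $\dim=4$, where $\hat\ddagger\begin{pmatrix}a&b\\c&d\end{pmatrix}=\begin{pmatrix}d^\ddagger&-b^\ddagger\\-c^\ddagger&a^\ddagger\end{pmatrix}$.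 $E(\mathbb{Z})$ is the subgroup of $G(\mathbb{Z})$ generated by its upper and lower triangular matrices. For $\alpha\in R(\mathbb{Z})^+$, $W(\alpha)=\begin{pmatrix}\alpha&1\\-1&0\end{pmatrix}$, and $\mathcal{W}$ is the group generated by all $W(\alpha)$, $\alpha\in R(\mathbb{Z})^+$. *)

theory Defs
  imports
    "HOL-Analysis.Analysis"
    "HOL-Computational_Algebra.Polynomial"
    "HOL-Algebra.Coset"
    "HOL-Algebra.Generated_Groups"
begin

section \<open>Hamilton quaternions\<close>

text \<open>
  All rings of interest are realized inside the Hamilton quaternions;
  \<open>Quat x y z t\<close> stands for \<open>x + yi + zj + tk\<close> with \<open>k = ij\<close>.
\<close>

datatype quat = Quat (q_re: real) (q_i: real) (q_j: real) (q_k: real)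

instantiation quat :: ring_1
begin

definition "0 = Quat 0 0 0 0"

definition "1 = Quat 1 0 0 0"

definition "p + q = Quat (q_re p + q_re q) (q_i p + q_i q) (q_j p + q_j q) (q_k p + q_k q)"

definition "p - q = Quat (q_re p - q_re q) (q_i p - q_i q) (q_j p - q_j q) (q_k p - q_k q)"

definition "- q = Quat (- q_re q) (- q_i q) (- q_j q) (- q_k q)"

definition "p * q = Quat
  (q_re p * q_re q - q_i p * q_i q - q_j p * q_j q - q_k p * q_k q)
  (q_re p * q_i q + q_i p * q_re q + q_j p * q_k q - q_k p * q_j q)
  (q_re p * q_j q - q_i p * q_k q + q_j p * q_re q + q_k p * q_i q)
  (q_re p * q_k q + q_i p * q_j q - q_j p * q_i q + q_k p * q_re q)"

instance
  by standard
    (auto simp: zero_quat_def one_quat_def plus_quat_def minus_quat_def uminus_quat_def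
        times_quat_def algebra_simps)

end

lemmas quat_defs = zero_quat_def one_quat_def plus_quat_def minus_quat_def uminus_quat_def
  times_quat_def

definition quat_of_complex :: "complex \<Rightarrow> quat" where
  "quat_of_complex z = Quat (Re z) (Im z) 0 0"

definition quat_of_rat :: "rat \<Rightarrow> quat" where
  "quat_of_rat r = Quat (of_rat r) 0 0 0"

definition ddag :: "quat \<Rightarrow> quat" where
  "ddag q = Quat (q_re q) (q_i q) (q_j q) (- q_k q)"

lemma ddag_mult: "ddag (p * q) = ddag q * ddag p"
  by (simp add: ddag_def times_quat_def algebra_simps)

lemma ddag_ddag: "ddag (ddag q) = q"
  by (simp add: ddag_def)

text \<open>The standard embedding of the Hamilton quaternions in the complex \<open>2 \<times> 2\<close> matrices.\<close>

definition quat_to_mat :: "quat \<Rightarrow> complex^2^2" where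
  "quat_to_mat q = vector [vector [Complex (q_re q) (q_i q), Complex (q_j q) (q_k q)],
                           vector [Complex (- q_j q) (q_k q), Complex (q_re q) (- q_i q)]]"

lemma quat_to_mat_mult: "quat_to_mat (p * q) = quat_to_mat p ** quat_to_mat q"
  by (simp add: vec_eq_iff forall_2 quat_to_mat_def matrix_matrix_mult_def sum_2
      times_quat_def complex_eq_iff algebra_simps)

lemma quat_to_mat_add: "quat_to_mat (p + q) = quat_to_mat p + quat_to_mat q"
  by (simp add: vec_eq_iff forall_2 quat_to_mat_def plus_quat_def complex_eq_iff)

lemma quat_to_mat_1: "quat_to_mat 1 = mat 1"
  by (simp add: vec_eq_iff forall_2 quat_to_mat_def one_quat_def complex_eq_iff mat_def)


section \<open>The rings \<open>R(\<int>)\<close>\<close>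

text \<open>
  Imaginary quadratic fields are the fields \<open>\<rat>(\<surd>(-d))\<close> with \<open>d \<ge> 1\<close> an integer; \<open>d\<close> need not be
  squarefree, so a field occurs for more than one \<open>d\<close>.
\<close>

definition imag_quadratic_field :: "nat \<Rightarrow> complex set" where
  "imag_quadratic_field d = {of_rat x + of_rat y * (\<i> * of_real (sqrt (real d))) | x y. True}"

definition imag_quadratic_integers :: "nat \<Rightarrow> complex set" where
  "imag_quadratic_integers d = {z \<in> imag_quadratic_field d. algebraic_int z}"

text \<open>
  For negative rationals \<open>a\<close>, \<open>b\<close> the definite algebra \<open>(a,b/\<rat>)\<close> is realized as the rational span
  of \<open>1\<close>, \<open>I\<close>, \<open>J\<close>, \<open>IJ\<close>, where \<open>I = \<surd>(-a) i\<close> and \<open>J = \<surd>(-b) j\<close>, so that the involution of the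
  algebra is the restriction of \<^const>\<open>ddag\<close> (see \<open>ddag_basis\<close> below).
\<close>

definition gen_I :: "rat \<Rightarrow> quat" where
  "gen_I a = Quat 0 (sqrt (of_rat (- a))) 0 0"

definition gen_J :: "rat \<Rightarrow> quat" where
  "gen_J b = Quat 0 0 (sqrt (of_rat (- b))) 0"

definition quat_alg :: "rat \<Rightarrow> rat \<Rightarrow> quat set" where
  "quat_alg a b = {quat_of_rat x + quat_of_rat y * gen_I a + quat_of_rat z * gen_J b
                     + quat_of_rat t * (gen_I a * gen_J b) | x y z t. True}"

lemma gen_I_sq: "a < 0 \<Longrightarrow> gen_I a * gen_I a = quat_of_rat a"
  by (simp add: gen_I_def times_quat_def quat_of_rat_def of_rat_minus)

lemma gen_J_sq: "b < 0 \<Longrightarrow> gen_J b * gen_J b = quat_of_rat b"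
  by (simp add: gen_J_def times_quat_def quat_of_rat_def of_rat_minus)

lemma gen_anticommute: "gen_J b * gen_I a = - (gen_I a * gen_J b)"
  by (simp add: gen_I_def gen_J_def times_quat_def uminus_quat_def)

lemma basis_independent:
  assumes "a < 0" "b < 0"
    and "quat_of_rat x + quat_of_rat y * gen_I a + quat_of_rat z * gen_J b
           + quat_of_rat t * (gen_I a * gen_J b) = 0"
  shows "x = 0 \<and> y = 0 \<and> z = 0 \<and> t = 0"
  using assms by (simp add: gen_I_def gen_J_def quat_of_rat_def quat_defs)

lemma ddag_basis:
  "ddag (quat_of_rat x + quat_of_rat y * gen_I a + quat_of_rat z * gen_J b
           + quat_of_rat t * (gen_I a * gen_J b))
     = quat_of_rat x + quat_of_rat y * gen_I a + quat_of_rat z * gen_J b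
           - quat_of_rat t * (gen_I a * gen_J b)"
  by (simp add: ddag_def gen_I_def gen_J_def quat_of_rat_def quat_defs)

text \<open>An order: a subring that is a finitely generated \<open>\<int>\<close>-module spanning the algebra over \<open>\<rat>\<close>.\<close>

definition is_order :: "quat set \<Rightarrow> quat set \<Rightarrow> bool" where
  "is_order A R \<longleftrightarrow>
     R \<subseteq> A \<and> 1 \<in> R \<and> (\<forall>x\<in>R. \<forall>y\<in>R. x - y \<in> R \<and> x * y \<in> R) \<and>
     (\<exists>B. finite B \<and> R = {(\<Sum>u\<in>B. of_int (c u) * u) | c. True}) \<and>
     (\<forall>x\<in>A. \<exists>n::nat. n > 0 \<and> of_nat n * x \<in> R)"

definition is_maximal_order :: "quat set \<Rightarrow> quat set \<Rightarrow> bool" where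
  "is_maximal_order A R \<longleftrightarrow>
     is_order A R \<and> (\<forall>R'. is_order A R' \<and> R \<subseteq> R' \<longrightarrow> R' = R)"

definition is_ddag_order :: "quat set \<Rightarrow> quat set \<Rightarrow> bool" where
  "is_ddag_order A R \<longleftrightarrow> is_order A R \<and> ddag ` R \<subseteq> R"

definition is_maximal_ddag_order :: "quat set \<Rightarrow> quat set \<Rightarrow> bool" where
  "is_maximal_ddag_order A R \<longleftrightarrow>
     is_ddag_order A R \<and> (\<forall>R'. is_ddag_order A R' \<and> R \<subseteq> R' \<longrightarrow> R' = R)"

definition is_RZ :: "nat \<Rightarrow> quat set \<Rightarrow> bool" where
  "is_RZ n R \<longleftrightarrow>
     (n = 3 \<and> (\<exists>d>0. R = quat_of_complex ` imag_quadratic_integers d)) \<or>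
     (n = 4 \<and> (\<exists>a b. a < 0 \<and> b < 0 \<and> is_maximal_ddag_order (quat_alg a b) R)) \<or>
     (n = 5 \<and> (\<exists>a b. a < 0 \<and> b < 0 \<and> is_maximal_order (quat_alg a b) R))"

definition RZ_plus :: "nat \<Rightarrow> quat set \<Rightarrow> quat set" where
  "RZ_plus n R = (if n = 4 then {x \<in> R. ddag x = x} else R)"


section \<open>The groups\<close>

definition mat2 :: "quat \<Rightarrow> quat \<Rightarrow> quat \<Rightarrow> quat \<Rightarrow> quat^2^2" where
  "mat2 a b c d = vector [vector [a, b], vector [c, d]]"

definition ddag_hat :: "quat^2^2 \<Rightarrow> quat^2^2" where
  "ddag_hat M = mat2 (ddag (M$2$2)) (- ddag (M$1$2)) (- ddag (M$2$1)) (ddag (M$1$1))"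

text \<open>
  The \<open>4 \<times> 4\<close> complex matrix obtained by replacing every entry by its \<open>2 \<times> 2\<close> block; the index
  \<open>(r, s)\<close> denotes row (or column) \<open>s\<close> within block row (or block column) \<open>r\<close>.
\<close>

definition block_mat :: "quat^2^2 \<Rightarrow> complex^(2 \<times> 2)^(2 \<times> 2)" where
  "block_mat M = (\<chi> p q. quat_to_mat (M $ fst p $ fst q) $ snd p $ snd q)"

text \<open>
  In dimension 3 the entries lie in the image of the complex numbers, hence commute, and the
  condition \<open>ad - bc = 1\<close> is the usual one on the \<open>2 \<times> 2\<close> determinant over a commutative ring.
\<close>

definition GZ :: "nat \<Rightarrow> quat set \<Rightarrow> (quat^2^2) set" where
  "GZ n R = {M. (\<forall>i j. M $ i $ j \<in> R) \<and>
     (if n = 3 then M$1$1 * M$2$2 - M$1$2 * M$2$1 = 1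
      else if n = 4 then ddag_hat M ** M = mat 1 \<and> M ** ddag_hat M = mat 1
      else det (block_mat M) = 1)}"

definition GZ_group :: "nat \<Rightarrow> quat set \<Rightarrow> (quat^2^2) monoid" where
  "GZ_group n R = \<lparr>carrier = GZ n R, monoid.mult = (**), one = mat 1\<rparr>"

definition EZ :: "nat \<Rightarrow> quat set \<Rightarrow> (quat^2^2) set" where
  "EZ n R = generate (GZ_group n R) {M \<in> GZ n R. M$2$1 = 0 \<or> M$1$2 = 0}"

definition EZ_group :: "nat \<Rightarrow> quat set \<Rightarrow> (quat^2^2) monoid" where
  "EZ_group n R = (GZ_group n R)\<lparr>carrier := EZ n R\<rparr>"

definition W :: "quat \<Rightarrow> quat^2^2" where
  "W \<alpha> = mat2 \<alpha> 1 (- 1) 0"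

definition W_grp :: "nat \<Rightarrow> quat set \<Rightarrow> (quat^2^2) set" where
  "W_grp n R = generate (GZ_group n R) (W ` RZ_plus n R)"

end

theory Submission
  imports Defs
begin

text \<open>
  Apart from commutativity in dimension 3 and stability under the involution in dimension 4, only two
  features of \<open>R\<close> matter: it is a subring of the Hamilton quaternions, and its elements have discrete
  coordinates. By the pigeonhole principle applied to powers, nonzero elements
  then have norm at least 1 and elements of norm 1 are units of finite order in \<open>R\<close>; hence all
  triangular matrices in \<open>G(\<int>)\<close> split as diagonal times unipotent, and there are only finitely many
  diagonal ones.

  Unipotent matrices are words in the \<open>W(a)\<close> up to sign, and diagonal matrices can be moved to the
  right past every \<open>W(a)\<close>, so every element of \<open>E(\<int>)\<close> is a word in the \<open>W(a)\<close> times a diagonal matrix.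
  The relations \<open>W(a) W(0) W(b) = - W(a + b)\<close>, \<open>W(a) W(1) W(b) = W(a - 1) W(b - 1)\<close> and
  \<open>W(a) W(-1) W(b) = - W(a + 1) W(b + 1)\<close> shorten words, so a word of minimal length has the required
  form. Cosets are represented by the finitely many diagonal matrices.
\<close>

section \<open>Discrete subrings of the quaternions\<close>

definition quat_norm :: "quat \<Rightarrow> real" where
  "quat_norm q = (q_re q)\<^sup>2 + (q_i q)\<^sup>2 + (q_j q)\<^sup>2 + (q_k q)\<^sup>2"

lemma quat_norm_mult: "quat_norm (p * q) = quat_norm p * quat_norm q"
  by (simp add: quat_norm_def times_quat_def power2_eq_square algebra_simps)

lemma quat_norm_one [simp]: "quat_norm 1 = 1"
  by (simp add: quat_norm_def one_quat_def)

lemma quat_norm_zero [simp]: "quat_norm 0 = 0"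
  by (simp add: quat_norm_def zero_quat_def)

lemma quat_norm_uminus [simp]: "quat_norm (- q) = quat_norm q"
  by (simp add: quat_norm_def uminus_quat_def)

lemma quat_norm_ddag [simp]: "quat_norm (ddag q) = quat_norm q"
  by (simp add: quat_norm_def ddag_def)

lemma quat_norm_nonneg [simp]: "0 \<le> quat_norm q"
  by (simp add: quat_norm_def)

lemma quat_norm_eq_0_iff [simp]: "quat_norm q = 0 \<longleftrightarrow> q = 0"
  by (cases q) (simp add: quat_norm_def zero_quat_def add_nonneg_eq_0_iff)

lemma quat_norm_power: "quat_norm (q ^ k) = quat_norm q ^ k"
  by (induction k) (simp_all add: quat_norm_mult)

lemma quat_mult_eq_0_iff: "p * q = 0 \<longleftrightarrow> p = 0 \<or> q = (0 :: quat)"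
  by (metis mult_eq_0_iff quat_norm_eq_0_iff quat_norm_mult)

text \<open>There are no zero divisors, and \<open>p * (q * p - 1) = 0\<close>.\<close>

lemma quat_mult_eq_1_commute:
  fixes p q :: quat
  assumes "p * q = 1"
  shows "q * p = 1"
proof -
  have "p * (q * p - 1) = 0"
    using assms by (simp add: right_diff_distrib flip: mult.assoc)
  moreover have "p \<noteq> 0"
    using assms by (metis mult_zero_left zero_neq_one)
  ultimately show ?thesis
    by (simp add: quat_mult_eq_0_iff)
qed

lemma ddag_simps [simp]:
  "ddag 0 = 0" "ddag 1 = 1" "ddag (- p) = - ddag p"
  "ddag (p + q) = ddag p + ddag q" "ddag (p - q) = ddag p - ddag q" "ddag (ddag p) = p"
  by (simp_all add: ddag_def quat_defs)

definition grid :: "real \<Rightarrow> real set" where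
  "grid s = range (\<lambda>m::int. of_int m * s)"

text \<open>Each coordinate has its own mesh size because the coordinates of an element of
  \<open>quat_alg a b\<close> are rational multiples of \<open>1\<close>, \<open>sqrt (- a)\<close>,
  \<open>sqrt (- b)\<close> and the product of these roots.\<close>

definition discrete_coords :: "quat set \<Rightarrow> bool" where
  "discrete_coords R \<longleftrightarrow> (\<exists>s1 s2 s3 s4. s1 > 0 \<and> s2 > 0 \<and> s3 > 0 \<and> s4 > 0 \<and>
     (\<forall>x\<in>R. q_re x \<in> grid s1 \<and> q_i x \<in> grid s2 \<and> q_j x \<in> grid s3 \<and> q_k x \<in> grid s4))"

lemma finite_grid_bounded:
  assumes "s > 0"
  shows "finite {x \<in> grid s. x\<^sup>2 \<le> C}"
proof (rule finite_subset)
  let ?M = "\<lceil>sqrt C / s\<rceil>"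
  show "{x \<in> grid s. x\<^sup>2 \<le> C} \<subseteq> (\<lambda>m::int. of_int m * s) ` {- ?M..?M}"
  proof
    fix x assume x: "x \<in> {x \<in> grid s. x\<^sup>2 \<le> C}"
    then obtain m :: int where m: "x = of_int m * s"
      by (auto simp: grid_def)
    have "\<bar>x\<bar> \<le> sqrt C"
      using x by (intro real_le_rsqrt) auto
    then have "\<bar>of_int m\<bar> \<le> sqrt C / s"
      using assms by (simp add: m abs_mult pos_le_divide_eq)
    then have "m \<in> {- ?M..?M}"
      by (auto simp: abs_le_iff) linarith+
    then show "x \<in> (\<lambda>m::int. of_int m * s) ` {- ?M..?M}"
      by (auto simp: m)
  qed
qed simp

lemma finite_discrete_coords_bounded:
  assumes "discrete_coords R"
  shows "finite {x \<in> R. quat_norm x \<le> C}"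
proof -
  obtain s1 s2 s3 s4 where s: "s1 > 0" "s2 > 0" "s3 > 0" "s4 > 0"
    and g: "\<And>x. x \<in> R \<Longrightarrow> q_re x \<in> grid s1 \<and> q_i x \<in> grid s2 \<and> q_j x \<in> grid s3 \<and> q_k x \<in> grid s4"
    using assms unfolding discrete_coords_def by blast
  let ?B = "\<lambda>s. {x \<in> grid s. x\<^sup>2 \<le> C}"
  have "{x \<in> R. quat_norm x \<le> C} \<subseteq>
          (\<lambda>(x, y, z, t). Quat x y z t) ` (?B s1 \<times> ?B s2 \<times> ?B s3 \<times> ?B s4)"
  proof
    fix x assume x: "x \<in> {x \<in> R. quat_norm x \<le> C}"
    have sq: "(q_re x)\<^sup>2 \<ge> 0" "(q_i x)\<^sup>2 \<ge> 0" "(q_j x)\<^sup>2 \<ge> 0" "(q_k x)\<^sup>2 \<ge> 0"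
      by simp_all
    have "(q_re x, q_i x, q_j x, q_k x) \<in> ?B s1 \<times> ?B s2 \<times> ?B s3 \<times> ?B s4"
      using x g[of x] sq unfolding quat_norm_def by (simp, linarith)
    then show "x \<in> (\<lambda>(x, y, z, t). Quat x y z t) ` (?B s1 \<times> ?B s2 \<times> ?B s3 \<times> ?B s4)"
      by (intro image_eqI[of _ _ "(q_re x, q_i x, q_j x, q_k x)"]) auto
  qed
  then show ?thesis
    by (rule finite_subset) (intro finite_imageI finite_cartesian_product finite_grid_bounded s)
qed

locale discrete_subring =
  fixes R :: "quat set"
  assumes one_closed: "1 \<in> R"
    and diff_closed: "x \<in> R \<Longrightarrow> y \<in> R \<Longrightarrow> x - y \<in> R"
    and mult_closed: "x \<in> R \<Longrightarrow> y \<in> R \<Longrightarrow> x * y \<in> R"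
    and discrete: "discrete_coords R"
begin

lemma zero_closed: "0 \<in> R"
  using diff_closed[OF one_closed one_closed] by simp

lemma uminus_closed: "x \<in> R \<Longrightarrow> - x \<in> R"
  using diff_closed[OF zero_closed] by simp

lemma add_closed: "x \<in> R \<Longrightarrow> y \<in> R \<Longrightarrow> x + y \<in> R"
  using diff_closed[of x "- y"] uminus_closed by simp

lemma power_closed: "x \<in> R \<Longrightarrow> x ^ k \<in> R"
  by (induction k) (auto intro: one_closed mult_closed)

lemma powers_collide:
  assumes "x \<in> R" "quat_norm x \<le> 1"
  obtains i j :: nat where "i < j" "x ^ i = x ^ j"
proof -
  have "range (\<lambda>k::nat. x ^ k) \<subseteq> {y \<in> R. quat_norm y \<le> 1}"
    using assms by (auto simp: power_closed quat_norm_power power_le_one)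
  then have "finite (range (\<lambda>k::nat. x ^ k))"
    using finite_discrete_coords_bounded[OF discrete] finite_subset by blast
  then have "\<not> inj (\<lambda>k::nat. x ^ k)"
    using finite_imageD infinite_UNIV_nat by blast
  then obtain i j :: nat where "x ^ i = x ^ j" "i \<noteq> j"
    by (auto simp: inj_def)
  then show ?thesis
    using that[of i j] that[of j i] by (cases "i < j") auto
qed

text \<open>If the norm were strictly between 0 and 1, the norms of the powers would strictly
  decrease, and no two powers could coincide as \<open>powers_collide\<close> demands.\<close>

lemma quat_norm_ge_1:
  assumes "x \<in> R" "x \<noteq> 0"
  shows "quat_norm x \<ge> 1"
proof (rule ccontr)
  assume "\<not> quat_norm x \<ge> 1"
  then have lt: "quat_norm x < 1" by simp
  obtain i j :: nat where ij: "i < j" "x ^ i = x ^ j"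
    using powers_collide[of x] assms lt by auto
  have "0 < quat_norm x"
    using assms(2) by (simp add: less_le)
  then have "quat_norm x ^ j < quat_norm x ^ i"
    using ij(1) lt by (intro power_strict_decreasing) auto
  then show False
    using ij(2) by (metis less_irrefl quat_norm_power)
qed

text \<open>Cancelling in \<open>x ^ i = x ^ j\<close> gives \<open>x ^ (j - i) = 1\<close>. The
  inverse is therefore itself a power of \<open>x\<close>, which keeps it in
  \<open>R\<close>.\<close>

lemma norm_one_invertible:
  assumes "x \<in> R" "quat_norm x = 1"
  obtains y where "y \<in> R" "x * y = 1" "y * x = 1"
proof -
  obtain i j :: nat where ij: "i < j" "x ^ i = x ^ j"
    using powers_collide[of x] assms by auto
  have "x ^ i * x ^ (j - i) = x ^ j"
    using ij(1) by (simp flip: power_add)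
  then have "x ^ i * (x ^ (j - i) - 1) = 0"
    using ij(2) by (metis diff_self mult.right_neutral right_diff_distrib)
  moreover have "x ^ i \<noteq> 0"
    using assms(2) by (metis power_one quat_norm_eq_0_iff quat_norm_power zero_neq_one)
  ultimately have "x ^ (j - i) = 1"
    by (simp add: quat_mult_eq_0_iff)
  then have "x * x ^ (j - i - 1) = 1"
    using ij(1) by (metis One_nat_def Suc_pred power_Suc zero_less_diff)
  then show ?thesis
    using that[of "x ^ (j - i - 1)"] quat_mult_eq_1_commute power_closed[OF assms(1)] by blast
qed

lemma norm_mult_eq_1:
  assumes "x \<in> R" "y \<in> R" "quat_norm x * quat_norm y = 1"
  shows "quat_norm x = 1" "quat_norm y = 1"
proof -
  have "x \<noteq> 0" "y \<noteq> 0"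
    using assms(3) by auto
  then have "quat_norm x \<ge> 1" "quat_norm y \<ge> 1"
    using assms quat_norm_ge_1 by auto
  then show "quat_norm x = 1" "quat_norm y = 1"
    using assms(3) mult_mono[of 1 "quat_norm x" "quat_norm y" "quat_norm y"]
      mult_mono[of 1 "quat_norm y" "quat_norm x" "quat_norm x"]
    by (auto simp: mult.commute)
qed

end

section \<open>Discreteness of orders in definite quaternion algebras\<close>

lemma grid_common:
  assumes "finite B" "s > 0" "\<And>u. u \<in> B \<Longrightarrow> \<exists>r. f u = of_rat r * s"
  obtains t where "t > 0" "\<And>u. u \<in> B \<Longrightarrow> f u \<in> grid t"
proof -
  \<comment> \<open>\<open>N\<close> is a common denominator for the elements treated so far; a new
    element with denominator \<open>b\<close> refines the mesh to
    \<open>s / (N * b)\<close>.\<close>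
  have "\<exists>N::int. N > 0 \<and> (\<forall>u\<in>B. f u \<in> grid (s / of_int N))"
    using assms(1,3)
  proof (induction B)
    case empty
    then show ?case by (intro exI[of _ 1]) auto
  next
    case (insert v B)
    then obtain N :: int where N: "N > 0" "\<forall>u\<in>B. f u \<in> grid (s / of_int N)"
      by auto
    obtain r where r: "f v = of_rat r * s"
      using insert.prems by auto
    obtain a b :: int where ab: "quotient_of r = (a, b)"
      by fastforce
    have b: "b > 0" and rab: "r = of_int a / of_int b"
      using quotient_of_denom_pos[OF ab] quotient_of_div[OF ab] by auto
    have "f v = of_int (a * N) * (s / of_int (N * b))"
      using b N(1) by (simp add: r rab of_rat_divide)
    then have "f v \<in> grid (s / of_int (N * b))"
      unfolding grid_def by blast
    moreover have "f u \<in> grid (s / of_int (N * b))" if "u \<in> B" for u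
    proof -
      have "f u \<in> grid (s / of_int N)"
        using N(2) that by blast
      then obtain m :: int where "f u = of_int m * (s / of_int N)"
        unfolding grid_def by (rule imageE)
      then have "f u = of_int (m * b) * (s / of_int (N * b))"
        using b N(1) by simp
      then show ?thesis unfolding grid_def by blast
    qed
    moreover have "N * b > 0" using b N(1) by simp
    ultimately show ?case
      by (intro exI[of _ "N * b"]) simp
  qed
  then obtain N :: int where "N > 0" "\<forall>u\<in>B. f u \<in> grid (s / of_int N)"
    by blast
  then show ?thesis
    using that[of "s / of_int N"] assms(2) by auto
qed

lemma grid_sum:
  assumes "\<And>u. u \<in> B \<Longrightarrow> f u \<in> grid t"
  shows "(\<Sum>u\<in>B. of_int (c u :: int) * f u) \<in> grid t"
proof -
  have "\<exists>m. \<forall>u\<in>B. f u = of_int (m u :: int) * t"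
    using assms by (intro bchoice) (auto simp: grid_def)
  then obtain m where "\<forall>u\<in>B. f u = of_int (m u :: int) * t" by blast
  then have "(\<Sum>u\<in>B. of_int (c u) * f u) = of_int (\<Sum>u\<in>B. c u * m u) * t"
    by (simp add: sum_distrib_right mult.assoc)
  then show ?thesis
    unfolding grid_def by blast
qed

lemma of_int_quat: "of_int m = Quat (of_int m) 0 0 0"
proof -
  have "of_nat n = Quat (of_nat n) 0 0 0" for n
    by (induction n) (simp_all add: quat_defs)
  then show ?thesis
    by (cases m rule: int_cases2) (simp_all add: uminus_quat_def)
qed

lemma quat_coord_sum:
  "q_re (\<Sum>u\<in>B. of_int (c u) * g u) = (\<Sum>u\<in>B. of_int (c u) * q_re (g u))"
  "q_i (\<Sum>u\<in>B. of_int (c u) * g u) = (\<Sum>u\<in>B. of_int (c u) * q_i (g u))"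
  "q_j (\<Sum>u\<in>B. of_int (c u) * g u) = (\<Sum>u\<in>B. of_int (c u) * q_j (g u))"
  "q_k (\<Sum>u\<in>B. of_int (c u) * g u) = (\<Sum>u\<in>B. of_int (c u) * q_k (g u))"
  by (induction B rule: infinite_finite_induct)
     (simp_all add: of_int_quat zero_quat_def plus_quat_def times_quat_def)

text \<open>The finitely many generators lie in the algebra, so each of their four coordinates has a
  common denominator, and integer combinations stay on the resulting grids.\<close>

lemma order_discrete_subring:
  assumes "is_order (quat_alg a b) R" "a < 0" "b < 0"
  shows "discrete_subring R"
proof
  show "1 \<in> R" and "\<And>x y. x \<in> R \<Longrightarrow> y \<in> R \<Longrightarrow> x - y \<in> R"
    and "\<And>x y. x \<in> R \<Longrightarrow> y \<in> R \<Longrightarrow> x * y \<in> R"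
    using assms(1) unfolding is_order_def by auto
  obtain B where B: "finite B" "R = {(\<Sum>u\<in>B. of_int (c u) * u) | c. True}"
    using assms(1) unfolding is_order_def by blast
  \<comment> \<open>\<open>is_order\<close> speaks only of integer combinations of \<open>B\<close>;
    indicator coefficients recover each single generator.\<close>
  have "u \<in> R" if "u \<in> B" for u
  proof -
    have "(\<Sum>v\<in>B. of_int (if v = u then 1 else 0) * v) = (\<Sum>v\<in>B. if v = u then v else 0)"
      by (intro sum.cong) auto
    also have "\<dots> = u"
      using B(1) that by (simp add: sum.delta)
    finally have "u = (\<Sum>v\<in>B. of_int (if v = u then 1 else 0) * v)" ..
    then show ?thesis
      unfolding B(2) by (intro CollectI exI[of _ "\<lambda>v. if v = u then 1 else 0"] conjI TrueI)
  qed
  then have BA: "u \<in> quat_alg a b" if "u \<in> B" for u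
    using assms(1) that unfolding is_order_def by blast
  define A' where "A' = sqrt (of_rat (- a))"
  define B' where "B' = sqrt (of_rat (- b))"
  have pos: "A' > 0" "B' > 0" "A' * B' > 0"
    using assms(2,3) by (auto simp: A'_def B'_def)
  have coords: "(\<exists>r. q_re u = of_rat r * 1) \<and> (\<exists>r. q_i u = of_rat r * A') \<and>
      (\<exists>r. q_j u = of_rat r * B') \<and> (\<exists>r. q_k u = of_rat r * (A' * B'))" if "u \<in> B" for u
    using BA[OF that]
    by (auto simp: quat_alg_def quat_of_rat_def gen_I_def gen_J_def times_quat_def
        plus_quat_def A'_def B'_def)
  obtain t1 where t1: "t1 > 0" "\<And>u. u \<in> B \<Longrightarrow> q_re u \<in> grid t1"
    using grid_common[OF B(1), of 1 q_re] coords by auto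
  obtain t2 where t2: "t2 > 0" "\<And>u. u \<in> B \<Longrightarrow> q_i u \<in> grid t2"
    using grid_common[OF B(1) pos(1), of q_i] coords by auto
  obtain t3 where t3: "t3 > 0" "\<And>u. u \<in> B \<Longrightarrow> q_j u \<in> grid t3"
    using grid_common[OF B(1) pos(2), of q_j] coords by auto
  obtain t4 where t4: "t4 > 0" "\<And>u. u \<in> B \<Longrightarrow> q_k u \<in> grid t4"
    using grid_common[OF B(1) pos(3), of q_k] coords by auto
  have "\<forall>x\<in>R. q_re x \<in> grid t1 \<and> q_i x \<in> grid t2 \<and> q_j x \<in> grid t3 \<and> q_k x \<in> grid t4"
  proof
    fix x assume "x \<in> R"
    then obtain c where x: "x = (\<Sum>u\<in>B. of_int (c u) * u)"
      unfolding B(2) by blast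
    show "q_re x \<in> grid t1 \<and> q_i x \<in> grid t2 \<and> q_j x \<in> grid t3 \<and> q_k x \<in> grid t4"
      unfolding x quat_coord_sum by (intro conjI grid_sum t1(2) t2(2) t3(2) t4(2))
  qed
  then show "discrete_coords R"
    unfolding discrete_coords_def
    by (intro exI[of _ t1] exI[of _ t2] exI[of _ t3] exI[of _ t4] conjI t1(1) t2(1) t3(1) t4(1))
qed

section \<open>Rings of integers of imaginary quadratic fields\<close>

lemma map_poly_of_int_add: "map_poly of_int (p + q) = map_poly of_int p + (map_poly of_int q :: 'a::comm_ring_1 poly)"
  by (simp add: poly_eq_iff coeff_map_poly)

lemma map_poly_of_int_mult:
  "map_poly of_int (p * q) = map_poly of_int p * (map_poly of_int q :: 'a::comm_ring_1 poly)"
  by (simp add: poly_eq_iff coeff_map_poly coeff_mult)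

lemma map_poly_of_int_smult:
  "map_poly of_int (smult a p) = smult (of_int a) (map_poly of_int p :: 'a::comm_ring_1 poly)"
  by (simp add: poly_eq_iff coeff_map_poly)

text \<open>Gauss's lemma: pseudo-division shows that \<open>q = aX\<^sup>2 + bX + c\<close> divides a scalar multiple of a monic polynomial
  vanishing at \<open>z\<close>, and comparing contents with leading coefficients gives \<open>content q = a\<close>.\<close>

lemma algebraic_int_quadratic_dvd:
  fixes z :: complex and a b c :: int
  assumes "algebraic_int z" "Im z \<noteq> 0" "a > 0"
    and root: "of_int a * z\<^sup>2 + of_int b * z + of_int c = 0"
  shows "a dvd b" "a dvd c"
proof -
  obtain p where p: "poly (map_poly of_int p) z = 0" "lead_coeff p = 1"
    using assms(1) unfolding algebraic_int_altdef_ipoly by blast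
  define q where "q = [:c, b, a:]"
  have q: "q \<noteq> 0" "degree q = 2" "lead_coeff q = a"
    using assms(3) by (auto simp: q_def)
  \<comment> \<open>Pseudo-division keeps all coefficients integral, at the price of the factor
    \<open>a ^ k\<close> on \<open>p\<close>.\<close>
  obtain h r where hr: "pseudo_divmod p q = (h, r)" by fastforce
  define k where "k = Suc (degree p) - degree q"
  have eq: "smult (a ^ k) p = q * h + r" and r: "r = 0 \<or> degree r < 2"
    using pseudo_divmod[OF q(1) hr] q by (auto simp: k_def)
  have "poly (map_poly of_int q) z = 0"
    using root by (simp add: q_def map_poly_pCons power2_eq_square algebra_simps)
  then have "poly (map_poly of_int r) z = 0"
    using arg_cong[OF eq, of "\<lambda>p. poly (map_poly of_int p) z"] p(1)
    by (simp add: map_poly_of_int_add map_poly_of_int_mult map_poly_of_int_smult)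
  moreover obtain u v where uv: "r = [:u, v:]"
  proof -
    have "r = [:coeff r 0, coeff r 1:]"
      using r by (auto simp: poly_eq_iff coeff_pCons coeff_eq_0 split: nat.splits)
    then show ?thesis by (rule that)
  qed
  \<comment> \<open>The remainder is at most linear with integer coefficients, and a nonreal number
    cannot be a root of it unless it vanishes.\<close>
  ultimately have "of_int u + z * of_int v = 0"
    by (simp add: map_poly_pCons)
  then have "v = 0" "u = 0"
    using assms(2) by (auto simp: complex_eq_iff)
  then have eq': "smult (a ^ k) p = q * h"
    using eq uv by simp
  have "content p dvd 1"
    using content_dvd_coeff[of p "degree p"] p(2) by simp
  then have "content p = 1"
    by (metis content_dvd_coeff is_unit_content_iff p(2) is_unit_normalize normalize_content)
  then have ck: "a ^ k = content q * content h"
    using arg_cong[OF eq', of content] assms(3) by (simp add: content_mult)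
  have lk: "a ^ k = a * lead_coeff h"
    using arg_cong[OF eq', of lead_coeff] p(2) q(3) assms(3) by (simp add: lead_coeff_mult)
  \<comment> \<open>Inserting \<open>a = content q * s\<close> and
    \<open>lead_coeff h = content h * t\<close> into
    \<open>content q * content h = a * lead_coeff h\<close> leaves \<open>s * t = 1\<close>, so
    \<open>a\<close> and \<open>content q\<close> agree up to a unit.\<close>
  obtain s where s: "a = content q * s"
    using content_dvd_coeff[of q "degree q"] q(3) by auto
  obtain t where t: "lead_coeff h = content h * t"
    using content_dvd_coeff[of h "degree h"] unfolding dvd_def by blast
  have "content q * content h \<noteq> 0"
    using ck assms(3) by (metis power_not_zero less_irrefl)
  moreover have "content q * content h * 1 = content q * content h * (s * t)"
    using ck lk s t by (metis mult.assoc mult.left_commute mult.right_neutral)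
  ultimately have "s * t = 1"
    by (metis mult_left_cancel)
  then have "a dvd content q"
    using s by (metis dvd_mult_unit_iff' dvd_refl dvdI mult.commute)
  then show "a dvd b" "a dvd c"
    using dvd_trans[OF _ content_dvd_coeff[of q 1]] dvd_trans[OF _ content_dvd_coeff[of q 0]]
    by (auto simp: q_def)
qed

text \<open>A square root of an algebraic integer is an algebraic integer, and rational algebraic
  integers are integers.\<close>

lemma Rats_sq_Ints:
  fixes x :: real
  assumes "x \<in> \<rat>" "x\<^sup>2 \<in> \<int>"
  shows "x \<in> \<int>"
proof -
  have "algebraic_int (x\<^sup>2)"
    using assms(2) by (rule int_imp_algebraic_int)
  then have "algebraic_int x"
    by (rule algebraic_int_root[where p = "monom 1 2"])
       (auto simp: poly_monom degree_monom_eq lead_coeff_monom)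
  then show ?thesis
    using assms(1) rational_algebraic_int_is_int by blast
qed

text \<open>Integrality is expressed by the trace \<open>2 * Re z\<close> and the norm of
  \<open>z\<close>. This turns closure under the ring operations and discreteness into integer
  arithmetic, uniformly in \<open>d\<close>.\<close>

lemma imag_quadratic_integers_iff:
  assumes "d > 0"
  shows "z \<in> imag_quadratic_integers d \<longleftrightarrow>
    (\<exists>y\<in>\<rat>. Im z = y * sqrt d) \<and> 2 * Re z \<in> \<int> \<and> (Re z)\<^sup>2 + (Im z)\<^sup>2 \<in> \<int>"
    (is "?L \<longleftrightarrow> ?R")
proof -
  have of_rat_complex: "of_rat r = complex_of_real (of_rat r)" for r
    by (cases r) (simp add: of_rat_rat)
  show ?thesis
  proof
    assume ?L
    then obtain x' y' :: rat where xy: "z = of_rat x' + of_rat y' * (\<i> * of_real (sqrt (real d)))"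
      and alg: "algebraic_int z"
      by (auto simp: imag_quadratic_integers_def imag_quadratic_field_def)
    define x y where "x = (of_rat x' :: real)" and "y = (of_rat y' :: real)"
    have Q: "x \<in> \<rat>" "y \<in> \<rat>" by (auto simp: x_def y_def)
    have z: "Re z = x" "Im z = y * sqrt d"
      by (simp_all add: xy of_rat_complex x_def y_def)
    have "2 * x \<in> \<int> \<and> x\<^sup>2 + (y * sqrt d)\<^sup>2 \<in> \<int>"
    \<comment> \<open>\<open>algebraic_int_quadratic_dvd\<close> requires a nonreal root, so real
      \<open>z\<close> are handled separately as rational algebraic integers.\<close>
    proof (cases "y = 0")
      case True
      then have "z = of_real x" using z by (simp add: complex_eq_iff)
      then have "algebraic_int x" using alg by simp
      then have "x \<in> \<int>" using Q rational_algebraic_int_is_int by blast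
      then show ?thesis using True by simp
    next
      case False
      have sq: "(y * sqrt d)\<^sup>2 = y\<^sup>2 * d" by (simp add: power_mult_distrib)
      have "2 * x \<in> \<rat>" "x\<^sup>2 + (y * sqrt d)\<^sup>2 \<in> \<rat>"
        using Q unfolding sq by auto
      \<comment> \<open>Trace and norm are written as fractions. Clearing denominators gives a
        quadratic equation for \<open>z\<close> with leading coefficient \<open>n1 * n2\<close>, and
        divisibility by it cancels to \<open>n1 dvd m1\<close> and \<open>n2 dvd m2\<close>.\<close>
      then obtain m1 n1 m2 n2 :: int where n: "n1 > 0" "n2 > 0" "2 * x = m1 / n1"
          "x\<^sup>2 + (y * sqrt d)\<^sup>2 = m2 / n2"
        by (metis Rats_cases')
      have "z\<^sup>2 - of_real (2 * x) * z + of_real (x\<^sup>2 + (y * sqrt d)\<^sup>2) = 0"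
        by (simp add: complex_eq_iff z power2_eq_square algebra_simps)
      then have "z\<^sup>2 - of_int m1 / of_int n1 * z + of_int m2 / of_int n2 = 0"
        unfolding n(3,4) by simp
      then have "of_int (n1 * n2) * z\<^sup>2 + of_int (- (m1 * n2)) * z + of_int (m2 * n1) = 0"
        using n(1,2) by (simp add: field_simps)
      moreover have "Im z \<noteq> 0" using z False assms by simp
      moreover have "n1 * n2 > 0" using n(1,2) by simp
      ultimately have "n1 * n2 dvd - (m1 * n2)" "n1 * n2 dvd m2 * n1"
        using algebraic_int_quadratic_dvd[OF alg] by blast+
      then have "n1 dvd m1" "n2 dvd m2"
        using n(1,2) by (auto simp: mult.commute)
      then show ?thesis
        unfolding n(3,4) using n(1,2) by (auto elim!: dvdE)
    qed
    then show ?R using z Q by auto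
  next
    assume R: ?R
    then obtain y where y: "y \<in> \<rat>" "Im z = y * sqrt d" by blast
    obtain t m :: int where tm: "2 * Re z = t" "(Re z)\<^sup>2 + (Im z)\<^sup>2 = m"
      using R by (auto elim!: Ints_cases)
    obtain y' where y': "y = of_rat y'" using y(1) by (auto elim: Rats_cases)
    have "z = of_rat (of_int t / 2) + of_rat y' * (\<i> * of_real (sqrt (real d)))"
    proof -
      have "of_rat y' = complex_of_real y" "of_rat (of_int t / 2) = complex_of_real (Re z)"
        using tm(1) by (simp_all add: y' of_rat_divide complex_eq_iff of_rat_complex)
      then show ?thesis by (simp add: complex_eq_iff y)
    qed
    then have "z \<in> imag_quadratic_field d"
      unfolding imag_quadratic_field_def by blast
    moreover have "algebraic_int z"
    proof
      let ?p = "[:of_int m, - of_int t, 1:] :: complex poly"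
      show "lead_coeff ?p = 1" by simp
      show "\<forall>i. coeff ?p i \<in> \<int>" by (auto simp: coeff_pCons split: nat.splits)
      have "of_real (of_int m) - of_real (of_int t) * z + z\<^sup>2 = 0"
        unfolding tm(1,2)[symmetric] by (simp add: complex_eq_iff power2_eq_square algebra_simps)
      then show "poly ?p z = 0" by (simp add: power2_eq_square algebra_simps)
    qed
    ultimately show ?L by (simp add: imag_quadratic_integers_def)
  qed
qed

lemma imag_quadratic_integersI:
  fixes t m :: int
  assumes "d > 0" "Im z = y * sqrt d" "y \<in> \<rat>" "2 * Re z = t" "(Re z)\<^sup>2 + (Im z)\<^sup>2 = m"
  shows "z \<in> imag_quadratic_integers d"
  unfolding imag_quadratic_integers_iff[OF assms(1)]
  by (intro conjI bexI[of _ y] assms(2,3)) (simp_all only: assms(4,5) Ints_of_int)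

text \<open>The crux is that \<open>p = 4 * Im z * Im w\<close> is an integer of the same parity as
  the product \<open>t * t'\<close> of the traces. It is rational, and its square is the integer
  \<open>(4 * m - t^2) * (4 * m' - t'^2)\<close>.\<close>

lemma imag_quadratic_integers_arith:
  assumes d: "d > 0" and zw: "z \<in> imag_quadratic_integers d" "w \<in> imag_quadratic_integers d"
  shows "z - w \<in> imag_quadratic_integers d" "z * w \<in> imag_quadratic_integers d"
proof -
  obtain y y' where y: "y \<in> \<rat>" "y' \<in> \<rat>" "Im z = y * sqrt d" "Im w = y' * sqrt d"
    using zw unfolding imag_quadratic_integers_iff[OF d] by blast
  obtain t t' m m' :: int where t: "2 * Re z = t" "2 * Re w = t'"
    and m: "(Re z)\<^sup>2 + (Im z)\<^sup>2 = m" "(Re w)\<^sup>2 + (Im w)\<^sup>2 = m'"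
    using zw unfolding imag_quadratic_integers_iff[OF d] by (auto elim!: Ints_cases)
  have Rats: "Re z \<in> \<rat>" "Re w \<in> \<rat>"
  proof -
    have "of_int k / 2 \<in> (\<rat> :: real set)" for k
      by (intro Rats_divide) simp_all
    moreover have "Re z = of_int t / 2" "Re w = of_int t' / 2"
      using t by simp_all
    ultimately show "Re z \<in> \<rat>" "Re w \<in> \<rat>"
      by metis+
  qed
  have P: "4 * Im z * Im w \<in> \<rat>"
  proof -
    have "4 * Im z * Im w = 4 * (y * y' * (sqrt d * sqrt d))"
      by (simp only: y(3,4) mult_ac)
    also have "\<dots> = 4 * (y * y' * d)"
      by simp
    finally show ?thesis
      using y(1,2) by (simp only:) (intro Rats_mult; simp)
  qed
  have "(4 * Im z * Im w)\<^sup>2 = (4 * of_int m - (2 * Re z)\<^sup>2) * (4 * of_int m' - (2 * Re w)\<^sup>2)"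
    unfolding m[symmetric] by (simp add: power2_eq_square algebra_simps)
  then have P2: "(4 * Im z * Im w)\<^sup>2 = of_int ((4 * m - t\<^sup>2) * (4 * m' - t'\<^sup>2))"
    by (simp add: t)
  then have "4 * Im z * Im w \<in> \<int>"
    using Rats_sq_Ints[OF P] by (metis Ints_of_int)
  then obtain p :: int where p: "4 * Im z * Im w = p"
    by (rule Ints_cases)
  have "p\<^sup>2 = (4 * m - t\<^sup>2) * (4 * m' - t'\<^sup>2)"
    using P2 unfolding p by (simp only: of_int_eq_iff flip: of_int_power)
  then have "even (p\<^sup>2) \<longleftrightarrow> even ((4 * m - t\<^sup>2) * (4 * m' - t'\<^sup>2))"
    by simp
  \<comment> \<open>Modulo 2 the identity for the square of \<open>p\<close> says that
    \<open>p\<close> and \<open>t * t'\<close> are congruent.\<close>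
  then have "even (t * t' + p)" "even (t * t' - p)"
    by simp_all
  \<comment> \<open>\<open>k\<close> and \<open>l\<close> turn out to be the traces of
    \<open>z * cnj w\<close> and \<open>z * w\<close>; the former also enters the norm of
    \<open>z - w\<close>.\<close>
  then obtain k l where kl: "t * t' + p = 2 * k" "t * t' - p = 2 * l"
    by (meson evenE)
  have kl': "2 * (Re z * Re w + Im z * Im w) = k" "2 * (Re z * Re w - Im z * Im w) = l"
  proof -
    have "4 * (Re z * Re w) = of_int (t * t')"
      by (simp flip: t)
    then have "2 * (2 * (Re z * Re w + Im z * Im w)) = of_int (t * t' + p)"
      "2 * (2 * (Re z * Re w - Im z * Im w)) = of_int (t * t' - p)"
      using p by simp_all
    then show "2 * (Re z * Re w + Im z * Im w) = k" "2 * (Re z * Re w - Im z * Im w) = l"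
      unfolding kl by simp_all
  qed
  have "Im (z - w) = (y - y') * sqrt d" "y - y' \<in> \<rat>"
    using y by (simp_all add: algebra_simps)
  moreover have "2 * Re (z - w) = of_int (t - t')"
    by (simp add: algebra_simps flip: t)
  moreover have "(Re (z - w))\<^sup>2 + (Im (z - w))\<^sup>2 = of_int (m + m' - k)"
    by (simp add: power2_eq_square algebra_simps flip: m kl')
  ultimately show "z - w \<in> imag_quadratic_integers d"
    using imag_quadratic_integersI[OF d] by blast
  have "Im (z * w) = (Re z * y' + y * Re w) * sqrt d" "Re z * y' + y * Re w \<in> \<rat>"
    using y Rats by (simp_all add: algebra_simps)
  moreover have "2 * Re (z * w) = of_int l"
    by (simp flip: kl')
  moreover have "(Re (z * w))\<^sup>2 + (Im (z * w))\<^sup>2 = of_int (m * m')"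
    by (simp add: power2_eq_square algebra_simps flip: m)
  ultimately show "z * w \<in> imag_quadratic_integers d"
    using imag_quadratic_integersI[OF d] by blast
qed

lemma quat_of_complex_hom:
  "quat_of_complex (z + w) = quat_of_complex z + quat_of_complex w"
  "quat_of_complex (z - w) = quat_of_complex z - quat_of_complex w"
  "quat_of_complex (z * w) = quat_of_complex z * quat_of_complex w"
  by (simp_all add: quat_of_complex_def plus_quat_def minus_quat_def times_quat_def)

lemma quat_of_complex_eq_1_iff [simp]: "quat_of_complex z = 1 \<longleftrightarrow> z = 1"
  by (simp add: quat_of_complex_def one_quat_def complex_eq_iff)

lemma imag_quadratic_discrete_subring:
  assumes d: "d > 0"
  shows "discrete_subring (quat_of_complex ` imag_quadratic_integers d)"
proof
  have "1 \<in> imag_quadratic_integers d"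
    unfolding imag_quadratic_integers_iff[OF d] by auto
  then show "1 \<in> quat_of_complex ` imag_quadratic_integers d"
    by (rule rev_image_eqI) (simp add: quat_of_complex_def one_quat_def)
  fix x y
  assume "x \<in> quat_of_complex ` imag_quadratic_integers d"
    "y \<in> quat_of_complex ` imag_quadratic_integers d"
  then obtain z w where zw: "z \<in> imag_quadratic_integers d" "w \<in> imag_quadratic_integers d"
    "x = quat_of_complex z" "y = quat_of_complex w"
    by blast
  have "x - y = quat_of_complex (z - w)" "x * y = quat_of_complex (z * w)"
    by (simp_all add: zw quat_of_complex_hom)
  then show "x - y \<in> quat_of_complex ` imag_quadratic_integers d"
    "x * y \<in> quat_of_complex ` imag_quadratic_integers d"
    using imag_quadratic_integers_arith[OF d zw(1,2)] by blast+
next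
  \<comment> \<open>The last conjunct serves the two vanishing coordinates of
    \<open>quat_of_complex z\<close>.\<close>
  have "Re z \<in> grid (1 / 2) \<and> Im z \<in> grid (1 / (2 * sqrt d)) \<and> 0 \<in> grid 1"
    if z: "z \<in> imag_quadratic_integers d" for z
  proof -
    obtain y where y: "y \<in> \<rat>" "Im z = y * sqrt d"
      using z unfolding imag_quadratic_integers_iff[OF d] by blast
    obtain t m :: int where t: "2 * Re z = t" and m: "(Re z)\<^sup>2 + (Im z)\<^sup>2 = m"
      using z unfolding imag_quadratic_integers_iff[OF d] by (auto elim!: Ints_cases)
    \<comment> \<open>\<open>2 * d * y\<close> is rational and its square is the integer
      \<open>d * (4 * m - t^2)\<close>, so it is an integer itself; this determines the mesh
      \<open>1 / (2 * sqrt d)\<close>.\<close>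
    have "(2 * d * y)\<^sup>2 = d * (4 * (y * sqrt d)\<^sup>2)"
      unfolding power_mult_distrib by (simp add: power2_eq_square)
    also have "4 * (y * sqrt d)\<^sup>2 = 4 * ((Re z)\<^sup>2 + (Im z)\<^sup>2) - (2 * Re z)\<^sup>2"
      unfolding power_mult_distrib y(2) by simp
    also have "d * \<dots> = of_int (int d * (4 * m - t\<^sup>2))"
      unfolding m t by simp
    finally have "(2 * d * y)\<^sup>2 \<in> \<int>"
      by (metis Ints_of_int)
    moreover have "2 * d * y \<in> \<rat>"
      using y(1) by simp
    ultimately have "2 * d * y \<in> \<int>"
      by (rule Rats_sq_Ints[rotated])
    then obtain p :: int where p: "2 * d * y = p"
      by (auto elim: Ints_cases)
    have "Im z = y * (d / sqrt d)"
      by (simp add: y(2) real_div_sqrt)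
    also have "\<dots> = 2 * d * y * (1 / (2 * sqrt d))"
      by simp
    finally have "Im z = of_int p * (1 / (2 * sqrt d))"
      unfolding p .
    moreover have "Re z = of_int t * (1 / 2)"
      using t by simp
    moreover have "0 = of_int 0 * (1::real)"
      by simp
    ultimately show ?thesis
      unfolding grid_def by (intro conjI; elim range_eqI)
  qed
  then show "discrete_coords (quat_of_complex ` imag_quadratic_integers d)"
    unfolding discrete_coords_def using d
    by (intro exI[of _ "1 / 2"] exI[of _ "1 / (2 * sqrt d)"] exI[of _ 1]) (auto simp: quat_of_complex_def)
qed

section \<open>Matrices over the quaternions\<close>

lemma mat2_nth [simp]:
  "mat2 a b c d $ 1 $ 1 = a" "mat2 a b c d $ 1 $ 2 = b"
  "mat2 a b c d $ 2 $ 1 = c" "mat2 a b c d $ 2 $ 2 = d"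
  by (simp_all add: mat2_def)

lemma mat2_eq_iff: "mat2 a b c d = mat2 a' b' c' d' \<longleftrightarrow> a = a' \<and> b = b' \<and> c = c' \<and> d = d'"
  by (auto simp: vec_eq_iff forall_2)

lemma mat2_cases: obtains a b c d where "M = mat2 a b c d"
proof
  show "M = mat2 (M$1$1) (M$1$2) (M$2$1) (M$2$2)"
    by (simp add: vec_eq_iff forall_2)
qed

lemma mat2_mult:
  "mat2 a b c d ** mat2 a' b' c' d' =
     mat2 (a * a' + b * c') (a * b' + b * d') (c * a' + d * c') (c * b' + d * d')"
  by (simp add: vec_eq_iff forall_2 matrix_matrix_mult_def sum_2)

lemma mat2_one: "mat 1 = mat2 1 0 0 1"
  by (simp add: vec_eq_iff forall_2 mat_def)

lemma mat2_uminus: "- mat2 a b c d = mat2 (- a) (- b) (- c) (- d)"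
  by (simp add: vec_eq_iff forall_2)

lemma ddag_hat_mat2: "ddag_hat (mat2 a b c d) = mat2 (ddag d) (- ddag b) (- ddag c) (ddag a)"
  by (simp add: ddag_hat_def)

lemma ddag_hat_mult: "ddag_hat (M ** N) = ddag_hat N ** ddag_hat M"
  by (cases M rule: mat2_cases; cases N rule: mat2_cases)
     (simp add: ddag_hat_mat2 mat2_mult mat2_eq_iff ddag_mult add.commute)

section \<open>Block matrices and their determinants\<close>

lemma block_mat_mult: "block_mat (M ** N) = block_mat M ** block_mat N"
proof -
  have pairs: "(\<Sum>k\<in>UNIV. f k) = (\<Sum>i\<in>UNIV. \<Sum>j\<in>UNIV. f (i, j))" for f :: "2 \<times> 2 \<Rightarrow> complex"
    by (simp add: sum.cartesian_product)
  have add: "quat_to_mat (x + y) $ i $ j = quat_to_mat x $ i $ j + quat_to_mat y $ i $ j" for x y i j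
    by (simp add: quat_to_mat_add)
  show ?thesis
    by (simp add: vec_eq_iff block_mat_def matrix_matrix_mult_def pairs sum_2 add quat_to_mat_mult)
qed

text \<open>This is the cofactor expansion along the first row, with the pairs \<open>p\<close>,
  \<open>q\<close>, \<open>r\<close>, \<open>s\<close> as the four indices; it comes from
  enumerating all permutations of the index set.\<close>

lemma det_22:
  fixes A :: "complex^(2\<times>2)^(2\<times>2)"
  shows "det A = (let a = (\<lambda>i j. A $ i $ j); p = (1,1); q = (1,2); r = (2,1); s = (2,2) in
    a p p * (a q q * (a r r * a s s - a r s * a s r) - a q r * (a r q * a s s - a r s * a s q)
                + a q s * (a r q * a s r - a r r * a s q))
  - a p q * (a q p * (a r r * a s s - a r s * a s r) - a q r * (a r p * a s s - a r s * a s p)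
                + a q s * (a r p * a s r - a r r * a s p))
  + a p r * (a q p * (a r q * a s s - a r s * a s q) - a q q * (a r p * a s s - a r s * a s p)
                + a q s * (a r p * a s q - a r q * a s p))
  - a p s * (a q p * (a r q * a s r - a r r * a s q) - a q q * (a r p * a s r - a r r * a s p)
                + a q r * (a r p * a s q - a r q * a s p)))"
proof -
  have U: "(UNIV :: (2 \<times> 2) set) = {(1,1), (1,2), (2,1), (2,2)}"
    using UNIV_2 by (simp flip: UNIV_Times_UNIV) auto
  have f1: "finite {(1,2), (2,1), (2,2) :: 2 \<times> 2}" "(1,1) \<notin> {(1,2), (2,1), (2,2) :: 2 \<times> 2}" by auto
  have f2: "finite {(2,1), (2,2) :: 2 \<times> 2}" "(1,2) \<notin> {(2,1), (2,2) :: 2 \<times> 2}" by auto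
  have f3: "finite {(2,2) :: 2 \<times> 2}" "(2,1) \<notin> {(2,2) :: 2 \<times> 2}" by auto
  show ?thesis
    unfolding det_def U Let_def
    unfolding sum_over_permutations_insert[OF f1]
    unfolding sum_over_permutations_insert[OF f2]
    unfolding sum_over_permutations_insert[OF f3]
    unfolding permutes_sing
    apply (simp add: sign_swap_id permutation_swap_id permutation_compose sign_compose sign_id swap_id_eq)
    apply (simp only: algebra_simps)
    done
qed


text \<open>The determinant of a block triangular matrix is the product over its diagonal blocks,
  and the block of a quaternion has its norm as determinant.\<close>

lemma det_block_upper: "det (block_mat (mat2 a b 0 d)) = of_real (quat_norm a * quat_norm d)"
  by (rule complex_eqI; simp add: det_22 Let_def block_mat_def quat_to_mat_def zero_quat_def quat_norm_def
       power2_eq_square; simp add: algebra_simps)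

lemma det_block_lower: "det (block_mat (mat2 a 0 c d)) = of_real (quat_norm a * quat_norm d)"
  by (rule complex_eqI; simp add: det_22 Let_def block_mat_def quat_to_mat_def zero_quat_def quat_norm_def
       power2_eq_square; simp add: algebra_simps)

text \<open>\<open>GZ_group n R\<close> enters below as a monoid, whereas the facts on generated
  subgroups need a group. Generation by units can be carried out in the group of units without
  changing the result.\<close>

lemma (in monoid) generate_units_of:
  assumes "H \<subseteq> Units G"
  shows "generate (units_of G) H = generate G H"
proof (intro subset_antisym subsetI)
  fix h assume "h \<in> generate (units_of G) H"
  then show "h \<in> generate G H"
  proof induction
    case (inv h)
    then show ?case
      using assms generate.inv[of h H G] by (auto simp: units_of_inv)
  qed (auto simp: units_of_one units_of_mult intro: generate.intros)
next
  fix h assume "h \<in> generate G H"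
  then show "h \<in> generate (units_of G) H"
  proof induction
    case one
    then show ?case using generate.one[of "units_of G"] by (simp add: units_of_one)
  next
    case (inv h)
    then show ?case
      using assms generate.inv[of h H "units_of G"] by (auto simp: units_of_inv)
  next
    case (eng h1 h2)
    then show ?case
      using generate.eng[of h1 "units_of G" H h2] by (simp add: units_of_mult)
  qed (auto intro: generate.incl)
qed

section \<open>Words in the matrices \<open>W a\<close> and the relations that shorten them\<close>

definition W_word :: "quat list \<Rightarrow> quat^2^2 \<Rightarrow> quat^2^2" where
  "W_word as M = foldr (\<lambda>a M. W a ** M) as M"

lemma W_word_simps [simp]:
  "W_word [] M = M" "W_word (a # as) M = W a ** W_word as M"
  by (simp_all add: W_word_def)

lemma W_word_append: "W_word (as @ bs) M = W_word as (W_word bs M)"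
  by (simp add: W_word_def)

lemma W_word_mult: "W_word as M ** N = W_word as (M ** N)"
  by (induction as) (simp_all flip: matrix_mul_assoc)

lemma matrix_mult_uminus_right: "(A :: quat^2^2) ** (- M :: quat^2^2) = - (A ** M)"
  by (cases A rule: mat2_cases; cases M rule: mat2_cases) (simp add: mat2_mult mat2_uminus mat2_eq_iff)

lemma W_word_uminus: "W_word as (- M) = - W_word as M"
  by (induction as) (simp_all add: matrix_mult_uminus_right)

text \<open>The arbitrary right factor \<open>M\<close> lets this relation and the next two act
  inside a word. A letter 0 shortens the word by two, a letter 1 or -1 by one.\<close>

lemma W_zero_reduce: "W a ** (W 0 ** (W b ** (M :: quat^2^2))) = - (W (a + b) ** M)"
  by (cases M rule: mat2_cases) (simp add: W_def mat2_mult mat2_uminus mat2_eq_iff algebra_simps)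

lemma W_one_reduce: "W a ** (W 1 ** (W b ** (M :: quat^2^2))) = W (a - 1) ** (W (b - 1) ** M)"
  by (cases M rule: mat2_cases) (simp add: W_def mat2_mult mat2_uminus mat2_eq_iff algebra_simps)

lemma W_minus_one_reduce: "W a ** (W (- 1) ** (W b ** (M :: quat^2^2))) = - (W (a + 1) ** (W (b + 1) ** M))"
  by (cases M rule: mat2_cases) (simp add: W_def mat2_mult mat2_uminus mat2_eq_iff algebra_simps)

section \<open>The groups\<close>

locale arithmetic_ring = discrete_subring R for R +
  fixes n :: nat
  assumes dim: "n \<in> {3, 4, 5}"
    and complex_entries: "n = 3 \<Longrightarrow> R \<subseteq> range quat_of_complex"
    and ddag_closed: "n = 4 \<Longrightarrow> x \<in> R \<Longrightarrow> ddag x \<in> R"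

lemma is_RZ_arithmetic_ring:
  assumes "n \<in> {3, 4, 5}" "is_RZ n R"
  shows "arithmetic_ring R n"
proof -
  consider (field) d where "n = 3" "d > 0" "R = quat_of_complex ` imag_quadratic_integers d"
    | (ddag) a b where "n = 4" "a < 0" "b < 0" "is_maximal_ddag_order (quat_alg a b) R"
    | (quat) a b where "n = 5" "a < 0" "b < 0" "is_maximal_order (quat_alg a b) R"
    using assms(2) unfolding is_RZ_def by blast
  then show ?thesis
  proof cases
    case field
    interpret discrete_subring R
      unfolding field(3) by (rule imag_quadratic_discrete_subring[OF field(2)])
    show ?thesis
      by unfold_locales (auto simp: field)
  next
    case ddag
    then have "is_order (quat_alg a b) R" "ddag ` R \<subseteq> R"
      unfolding is_maximal_ddag_order_def is_ddag_order_def by auto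
    then interpret discrete_subring R
      using order_discrete_subring ddag by blast
    show ?thesis
      using \<open>ddag ` R \<subseteq> R\<close> by unfold_locales (auto simp: ddag)
  next
    case quat
    then interpret discrete_subring R
      using order_discrete_subring unfolding is_maximal_order_def by blast
    show ?thesis
      by unfold_locales (auto simp: quat)
  qed
qed

lemma mat2_in_GZ_iff:
  "mat2 a b c d \<in> GZ n R \<longleftrightarrow> a \<in> R \<and> b \<in> R \<and> c \<in> R \<and> d \<in> R \<and>
     (if n = 3 then a * d - b * c = 1
      else if n = 4 then ddag_hat (mat2 a b c d) ** mat2 a b c d = mat 1 \<and>
        mat2 a b c d ** ddag_hat (mat2 a b c d) = mat 1
      else det (block_mat (mat2 a b c d)) = 1)"
  by (auto simp: GZ_def forall_2)

context arithmetic_ring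
begin

lemma RZ_plus_subset: "RZ_plus n R \<subseteq> R"
  by (auto simp: RZ_plus_def)

lemma RZ_plus_closed:
  "0 \<in> RZ_plus n R" "1 \<in> RZ_plus n R"
  "x \<in> RZ_plus n R \<Longrightarrow> - x \<in> RZ_plus n R"
  "x \<in> RZ_plus n R \<Longrightarrow> y \<in> RZ_plus n R \<Longrightarrow> x + y \<in> RZ_plus n R"
  "x \<in> RZ_plus n R \<Longrightarrow> y \<in> RZ_plus n R \<Longrightarrow> x - y \<in> RZ_plus n R"
  by (auto simp: RZ_plus_def zero_closed one_closed uminus_closed add_closed diff_closed
      split: if_splits)

text \<open>Each defining condition is multiplicative: the determinant over the complex numbers, the
  anti-automorphism \<open>ddag_hat\<close>, and the determinant of the block matrix.\<close>

lemma GZ_mult: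
  assumes "M \<in> GZ n R" "N \<in> GZ n R"
  shows "M ** N \<in> GZ n R"
proof -
  obtain a b c d where M: "M = mat2 a b c d" by (rule mat2_cases)
  obtain a' b' c' d' where N: "N = mat2 a' b' c' d'" by (rule mat2_cases)
  have entries: "a \<in> R" "b \<in> R" "c \<in> R" "d \<in> R" "a' \<in> R" "b' \<in> R" "c' \<in> R" "d' \<in> R"
    using assms by (auto simp: M N mat2_in_GZ_iff)
  have closed: "M ** N \<in> GZ n R \<longleftrightarrow>
     (if n = 3 then (M ** N)$1$1 * (M ** N)$2$2 - (M ** N)$1$2 * (M ** N)$2$1 = 1
      else if n = 4 then ddag_hat (M ** N) ** (M ** N) = mat 1 \<and> (M ** N) ** ddag_hat (M ** N) = mat 1
      else det (block_mat (M ** N)) = 1)"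
    unfolding M N mat2_mult mat2_in_GZ_iff mat2_nth
    using entries by (simp add: add_closed mult_closed)
  consider "n = 3" | "n = 4" | "n = 5"
    using dim by blast
  then show ?thesis
  proof cases
    case 1
    \<comment> \<open>The identity for determinants needs commuting entries, so the entries are
      pulled back to complex numbers.\<close>
    obtain z w x y z' w' x' y' where qc:
      "a = quat_of_complex z" "b = quat_of_complex w" "c = quat_of_complex x" "d = quat_of_complex y"
      "a' = quat_of_complex z'" "b' = quat_of_complex w'" "c' = quat_of_complex x'"
      "d' = quat_of_complex y'"
      using entries complex_entries[OF 1] by (meson imageE subsetD)
    have det: "z * y - w * x = 1" "z' * y' - w' * x' = 1"
      using assms 1 by (auto simp: M N mat2_in_GZ_iff quat_of_complex_hom[symmetric] qc)
    have "(z * z' + w * x') * (x * w' + y * y') - (z * w' + w * y') * (x * z' + y * x') =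
        (z * y - w * x) * (z' * y' - w' * x')"
      by (simp add: algebra_simps)
    then show ?thesis
      unfolding closed using 1 det by (simp add: M N mat2_mult qc quat_of_complex_hom[symmetric])
  next
    case 2
    have "ddag_hat M ** M = mat 1" "M ** ddag_hat M = mat 1" "ddag_hat N ** N = mat 1"
      "N ** ddag_hat N = mat 1"
      using assms 2 by (auto simp: M N mat2_in_GZ_iff)
    then show ?thesis
      unfolding closed ddag_hat_mult using 2
      by simp (metis matrix_mul_assoc matrix_mul_lid)
  next
    case 3
    have "det (block_mat M) = 1" "det (block_mat N) = 1"
      using assms 3 by (auto simp: M N mat2_in_GZ_iff)
    then show ?thesis
      unfolding closed block_mat_mult det_mul using 3 by simp
  qed
qed

text \<open>In every dimension the group condition forces
  \<open>quat_norm a * quat_norm d = 1\<close>, and nonzero elements of \<open>R\<close> have norm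
  at least 1.\<close>

lemma GZ_triangular_norm:
  assumes "mat2 a b c d \<in> GZ n R" "b = 0 \<or> c = 0"
  shows "quat_norm a = 1" "quat_norm d = 1"
proof -
  have R: "a \<in> R" "d \<in> R"
    using assms(1) by (auto simp: mat2_in_GZ_iff)
  consider "n = 3" | "n = 4" | "n = 5"
    using dim by blast
  then have "quat_norm a * quat_norm d = 1"
  proof cases
    case 1
    then have "a * d = 1"
      using assms by (auto simp: mat2_in_GZ_iff)
    then show ?thesis
      by (metis quat_norm_mult quat_norm_one)
  next
    case 2
    then have "ddag d * a = 1 \<or> a * ddag d = 1"
      using assms by (auto simp: mat2_in_GZ_iff ddag_hat_mat2 mat2_mult mat2_one mat2_eq_iff)
    then show ?thesis
      by (metis mult.commute quat_norm_ddag quat_norm_mult quat_norm_one)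
  next
    case 3
    then have "complex_of_real (quat_norm a * quat_norm d) = 1"
      using assms by (auto simp: mat2_in_GZ_iff det_block_upper det_block_lower)
    then show ?thesis
      using of_real_eq_1_iff by blast
  qed
  then show "quat_norm a = 1" "quat_norm d = 1"
    using norm_mult_eq_1 R by blast+
qed

section \<open>Diagonal and triangular matrices in \<open>GZ n R\<close>\<close>

definition diags :: "(quat \<times> quat) set" where
  "diags = {(u, v). mat2 u 0 0 v \<in> GZ n R}"

text \<open>One description covers all dimensions: the norm equation is the block determinant
  condition of dimension 5, and the equation with \<open>ddag\<close> condenses the two matrix
  identities of dimension 4.\<close>

lemma diags_iff:
  "(u, v) \<in> diags \<longleftrightarrow> u \<in> R \<and> v \<in> R \<and> (n = 3 \<longrightarrow> u * v = 1) \<and> (n = 4 \<longrightarrow> ddag u * v = 1) \<and>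
     quat_norm u * quat_norm v = 1"
  (is "?L \<longleftrightarrow> ?R")
proof
  assume ?L
  then have G: "mat2 u 0 0 v \<in> GZ n R"
    by (simp add: diags_def)
  then show ?R
    using GZ_triangular_norm[OF G]
    by (auto simp: mat2_in_GZ_iff ddag_hat_mat2 mat2_mult mat2_one mat2_eq_iff)
next
  assume R: ?R
  consider "n = 3" | "n = 4" | "n = 5"
    using dim by blast
  then show ?L
  proof cases
    case 2
    then have eq: "ddag u * v = 1" using R by blast
    then have "ddag v * u = 1"
      by (metis ddag_mult ddag_simps(2,6))
    then show ?thesis
      using R 2 eq quat_mult_eq_1_commute[OF eq] quat_mult_eq_1_commute[of "ddag v" u]
      unfolding diags_def by (simp add: mat2_in_GZ_iff zero_closed ddag_hat_mat2 mat2_mult mat2_one)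
  qed (use R in \<open>unfold diags_def mem_Collect_eq case_prod_conv mat2_in_GZ_iff,
      auto simp: zero_closed det_block_upper simp flip: of_real_mult\<close>)
qed

lemma diags_norm:
  assumes "(u, v) \<in> diags"
  shows "u \<in> R" "v \<in> R" "quat_norm u = 1" "quat_norm v = 1"
  using assms norm_mult_eq_1 unfolding diags_iff by blast+

lemma finite_diags: "finite diags"
proof (rule finite_subset)
  let ?U = "{x \<in> R. quat_norm x \<le> 1}"
  show "diags \<subseteq> ?U \<times> ?U"
    using diags_norm by fastforce
  show "finite (?U \<times> ?U)"
    using finite_discrete_coords_bounded[OF discrete] by simp
qed

lemma diags_minus_one: "(- 1, - 1) \<in> diags"
  by (simp add: diags_iff uminus_closed one_closed)

lemma diags_uminus: "(u, v) \<in> diags \<Longrightarrow> (- u, - v) \<in> diags"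
  by (simp add: diags_iff uminus_closed)

lemma diags_mult: "(u, v) \<in> diags \<Longrightarrow> (u', v') \<in> diags \<Longrightarrow> (u * u', v * v') \<in> diags"
  using GZ_mult[of "mat2 u 0 0 v" "mat2 u' 0 0 v'"] by (simp add: diags_def mat2_mult)

text \<open>Moving a diagonal matrix past a letter \<open>W a\<close> exchanges its two
  entries.\<close>

lemma diags_swap:
  assumes "(u, v) \<in> diags"
  shows "(v, u) \<in> diags"
proof -
  have "ddag v * u = 1" if "ddag u * v = 1"
    using that by (metis ddag_mult ddag_simps(2,6))
  then show ?thesis
    using assms quat_mult_eq_1_commute by (auto simp: diags_iff mult.commute)
qed

lemma diags_inverse:
  assumes "(u, v) \<in> diags"
  obtains u' v' where "(u', v') \<in> diags" "u * u' = 1" "u' * u = 1" "v * v' = 1" "v' * v = 1"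
proof -
  note uv = diags_norm[OF assms]
  obtain u' where u': "u' \<in> R" "u * u' = 1" "u' * u = 1"
    using norm_one_invertible[OF uv(1,3)] .
  obtain v' where v': "v' \<in> R" "v * v' = 1" "v' * v = 1"
    using norm_one_invertible[OF uv(2,4)] .
  have "quat_norm u' = 1" "quat_norm v' = 1"
    using u'(2) v'(2) uv by (metis mult_1 quat_norm_mult quat_norm_one)+
  moreover have "u' * v' = 1" if "n = 3"
  proof -
    have "u * v = 1" using assms that unfolding diags_iff by blast
    then have "u' = v" by (metis mult.assoc mult.right_neutral mult_1 u'(3))
    then show ?thesis using v' by simp
  qed
  moreover have "ddag u' * v' = 1" if "n = 4"
  proof -
    have uv4: "ddag u * v = 1" using assms that unfolding diags_iff by blast
    have "ddag u' * ddag u = 1" using u'(2) by (simp flip: ddag_mult)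
    then have "ddag u' = v" by (metis mult.assoc mult.right_neutral mult_1 uv4)
    then show ?thesis using v' by simp
  qed
  ultimately have "(u', v') \<in> diags"
    by (simp add: diags_iff u' v')
  then show ?thesis
    using that u' v' by blast
qed

text \<open>\<open>a'\<close> is \<open>u * a\<close> times the inverse of \<open>v\<close>, the
  letter that appears when the diagonal matrix passes \<open>W a\<close>. In dimension 4 that
  inverse is \<open>ddag u\<close>, so \<open>a' = u * a * ddag u\<close> is again fixed by
  \<open>ddag\<close>.\<close>

lemma diags_twist:
  assumes "(u, v) \<in> diags" "a \<in> RZ_plus n R"
  obtains a' where "a' \<in> RZ_plus n R" "a' * v = u * a"
proof -
  note uv = diags_norm[OF assms(1)]
  obtain w where w: "w \<in> R" "v * w = 1" "w * v = 1"
    using norm_one_invertible[OF uv(2,4)] .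
  have "u * a * w \<in> R"
    using assms(2) RZ_plus_subset uv w by (auto intro: mult_closed)
  moreover have "ddag (u * a * w) = u * a * w" if "n = 4"
  proof -
    have "ddag u * v = 1" using assms(1) that unfolding diags_iff by blast
    then have "w = ddag u" by (metis mult.assoc mult.right_neutral mult_1 w(2))
    then show ?thesis
      using assms(2) that by (simp add: RZ_plus_def ddag_mult mult.assoc)
  qed
  ultimately show ?thesis
    using that[of "u * a * w"] w(3) by (simp add: RZ_plus_def mult.assoc)
qed

text \<open>The matrix is the diagonal matrix of \<open>a\<close>, \<open>d\<close> times the
  unipotent one with entry \<open>x\<close>, the inverse of \<open>a\<close> times \<open>b\<close>.
  In dimension 4 that inverse is \<open>ddag d\<close>, and the off-diagonal condition says exactly
  that \<open>x\<close> is fixed by \<open>ddag\<close>.\<close>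

lemma GZ_upper_factor:
  assumes "mat2 a b 0 d \<in> GZ n R"
  shows "(a, d) \<in> diags" "\<exists>x \<in> RZ_plus n R. b = a * x"
proof -
  have R: "a \<in> R" "b \<in> R" "d \<in> R"
    using assms by (auto simp: mat2_in_GZ_iff)
  have norm: "quat_norm a = 1" "quat_norm d = 1"
    using GZ_triangular_norm[OF assms] by auto
  have eq4: "ddag d * a = 1 \<and> ddag a * d = 1 \<and> ddag b * d = ddag d * b" if "n = 4"
    using assms that by (auto simp: mat2_in_GZ_iff ddag_hat_mat2 mat2_mult mat2_one mat2_eq_iff)
  show "(a, d) \<in> diags"
    using assms R norm eq4 by (auto simp: diags_iff mat2_in_GZ_iff)
  obtain a' where a': "a' \<in> R" "a * a' = 1" "a' * a = 1"
    using norm_one_invertible[OF R(1) norm(1)] .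
  have "ddag (a' * b) = a' * b" if "n = 4"
  proof -
    have "a' = ddag d"
      by (metis a'(2) eq4 that mult.assoc mult.right_neutral mult_1)
    then show ?thesis using eq4 that by (simp add: ddag_mult)
  qed
  then have "a' * b \<in> RZ_plus n R"
    using a' R by (simp add: RZ_plus_def mult_closed)
  then show "\<exists>x \<in> RZ_plus n R. b = a * x"
    using a'(2) by (intro bexI[of _ "a' * b"]) (simp_all flip: mult.assoc)
qed

text \<open>Here the diagonal factor scales the lower row by \<open>d\<close>, so \<open>x\<close>
  is the inverse of \<open>d\<close> times \<open>c\<close>; in dimension 4 that inverse is
  \<open>ddag a\<close>.\<close>

lemma GZ_lower_factor:
  assumes "mat2 a 0 c d \<in> GZ n R"
  shows "(a, d) \<in> diags" "\<exists>x \<in> RZ_plus n R. c = d * x"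
proof -
  have R: "a \<in> R" "c \<in> R" "d \<in> R"
    using assms by (auto simp: mat2_in_GZ_iff)
  have norm: "quat_norm a = 1" "quat_norm d = 1"
    using GZ_triangular_norm[OF assms] by auto
  have eq4: "ddag a * d = 1 \<and> ddag c * a = ddag a * c" if "n = 4"
    using assms that by (auto simp: mat2_in_GZ_iff ddag_hat_mat2 mat2_mult mat2_one mat2_eq_iff)
  show "(a, d) \<in> diags"
    using assms R norm eq4 by (auto simp: diags_iff mat2_in_GZ_iff)
  obtain d' where d': "d' \<in> R" "d * d' = 1" "d' * d = 1"
    using norm_one_invertible[OF R(3) norm(2)] .
  have "ddag (d' * c) = d' * c" if "n = 4"
  proof -
    have "d' = ddag a"
      by (metis d'(2) eq4 that mult.assoc mult.right_neutral mult_1)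
    then show ?thesis using eq4 that by (simp add: ddag_mult)
  qed
  then have "d' * c \<in> RZ_plus n R"
    using d' R by (simp add: RZ_plus_def mult_closed)
  then show "\<exists>x \<in> RZ_plus n R. c = d * x"
    using d'(2) by (intro bexI[of _ "d' * c"]) (simp_all flip: mult.assoc)
qed

lemma unipotent_in_GZ:
  assumes "x \<in> RZ_plus n R"
  shows "mat2 1 x 0 1 \<in> GZ n R" "mat2 1 0 x 1 \<in> GZ n R"
  using assms dim
  by (auto simp: mat2_in_GZ_iff RZ_plus_def zero_closed one_closed ddag_hat_mat2 mat2_mult mat2_one
      det_block_upper det_block_lower)


section \<open>Factorizations into a word and a diagonal matrix\<close>

abbreviation "G \<equiv> GZ_group n R"

text \<open>The inner letters are still unrestricted here; the restriction is obtained later by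
  minimizing the length.\<close>

definition is_form :: "quat^2^2 \<Rightarrow> quat list \<Rightarrow> bool" where
  "is_form \<gamma> as \<longleftrightarrow> as \<noteq> [] \<and> set as \<subseteq> RZ_plus n R \<and>
     (\<exists>u v. (u, v) \<in> diags \<and> \<gamma> = W_word as (mat2 u 0 0 v))"

lemma is_form_Cons: "is_form \<gamma> as \<Longrightarrow> a \<in> RZ_plus n R \<Longrightarrow> is_form (W a ** \<gamma>) (a # as)"
  unfolding is_form_def by auto

text \<open>The diagonal matrix passes one letter at a time by \<open>diags_twist\<close>. Its
  entries are exchanged at each letter, hence the induction over arbitrary \<open>u\<close> and
  \<open>v\<close>.\<close>

lemma diag_W_word:
  assumes "(u, v) \<in> diags" "set as \<subseteq> RZ_plus n R"
  shows "\<exists>bs p q. length bs = length as \<and> set bs \<subseteq> RZ_plus n R \<and> (p, q) \<in> diags \<and>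
           mat2 u 0 0 v ** W_word as M = W_word bs (mat2 p 0 0 q ** M)"
  using assms
proof (induction as arbitrary: u v)
  case Nil
  then show ?case by (intro exI[of _ "[]"]) auto
next
  case (Cons a as)
  obtain a' where a': "a' \<in> RZ_plus n R" "a' * v = u * a"
    using diags_twist[of u v a] Cons.prems by auto
  obtain bs p q where bs: "length bs = length as" "set bs \<subseteq> RZ_plus n R" "(p, q) \<in> diags"
    "mat2 v 0 0 u ** W_word as M = W_word bs (mat2 p 0 0 q ** M)"
    using Cons.IH[OF diags_swap[OF Cons.prems(1)]] Cons.prems(2) by auto
  have "mat2 u 0 0 v ** W a = W a' ** mat2 v 0 0 u"
    using a'(2) by (simp add: W_def mat2_mult)
  then have "mat2 u 0 0 v ** W_word (a # as) M = W_word (a' # bs) (mat2 p 0 0 q ** M)"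
    using bs(4) by (simp add: matrix_mul_assoc) (simp flip: matrix_mul_assoc)
  then show ?case
    using a' bs by (intro exI[of _ "a' # bs"] exI[of _ p] exI[of _ q]) auto
qed

lemma is_form_diag:
  assumes "(u, v) \<in> diags" "is_form \<gamma> as"
  shows "\<exists>bs. is_form (mat2 u 0 0 v ** \<gamma>) bs"
proof -
  obtain s t where st: "(s, t) \<in> diags" "\<gamma> = W_word as (mat2 s 0 0 t)"
    using assms(2) unfolding is_form_def by blast
  have as: "as \<noteq> []" "set as \<subseteq> RZ_plus n R"
    using assms(2) unfolding is_form_def by auto
  obtain bs p q where "length bs = length as" "set bs \<subseteq> RZ_plus n R" "(p, q) \<in> diags"
      "mat2 u 0 0 v ** \<gamma> = W_word bs (mat2 p 0 0 q ** mat2 s 0 0 t)"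
    using diag_W_word[OF assms(1) as(2)] st(2) by blast
  moreover from this have "(p * s, q * t) \<in> diags"
    using diags_mult st(1) by blast
  ultimately have "is_form (mat2 u 0 0 v ** \<gamma>) bs"
    using as(1) unfolding is_form_def by (auto simp: mat2_mult)
  then show ?thesis ..
qed

text \<open>The sign is written as a diagonal matrix so that \<open>is_form_diag\<close> can absorb
  it.\<close>

lemma unipotent_W:
  "mat2 1 x 0 1 ** \<gamma> = W (- x) ** (W 0 ** (mat2 (- 1) 0 0 (- 1) ** \<gamma>))"
  "mat2 1 0 x 1 ** \<gamma> = W 0 ** (W x ** (mat2 (- 1) 0 0 (- 1) ** \<gamma>))"
  by (simp_all add: W_def mat2_mult matrix_mul_assoc)

lemma is_form_unipotent:
  assumes "x \<in> RZ_plus n R" "is_form \<gamma> as"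
  shows "\<exists>bs. is_form (mat2 1 x 0 1 ** \<gamma>) bs" "\<exists>bs. is_form (mat2 1 0 x 1 ** \<gamma>) bs"
proof -
  obtain bs where "is_form (mat2 (- 1) 0 0 (- 1) ** \<gamma>) bs"
    using is_form_diag[OF diags_minus_one assms(2)] by blast
  then show "\<exists>bs. is_form (mat2 1 x 0 1 ** \<gamma>) bs" "\<exists>bs. is_form (mat2 1 0 x 1 ** \<gamma>) bs"
    unfolding unipotent_W using assms(1) RZ_plus_closed by (blast intro: is_form_Cons)+
qed

text \<open>Words must be nonempty, so the identity is represented through
  \<open>W 0 ** W 0 = - mat 1\<close>.\<close>

lemma is_form_one: "is_form (mat 1) [0, 0]"
  unfolding is_form_def using RZ_plus_closed diags_minus_one
  by (intro conjI exI[of _ "- 1"]) (auto simp: W_def mat2_mult mat2_one)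

lemma is_form_triangular:
  assumes "M \<in> GZ n R" "M $ 2 $ 1 = 0 \<or> M $ 1 $ 2 = 0" "is_form \<gamma> as"
  shows "\<exists>bs. is_form (M ** \<gamma>) bs"
proof -
  obtain a b c d where M: "M = mat2 a b c d" by (rule mat2_cases)
  show ?thesis
  proof (cases "c = 0")
    case True
    then obtain x where x: "(a, d) \<in> diags" "x \<in> RZ_plus n R" "b = a * x"
      using GZ_upper_factor assms(1) M by blast
    have "M ** \<gamma> = mat2 a 0 0 d ** (mat2 1 x 0 1 ** \<gamma>)"
      by (simp add: M True x(3) mat2_mult matrix_mul_assoc)
    then show ?thesis
      using is_form_unipotent(1)[OF x(2) assms(3)] is_form_diag[OF x(1)] by auto
  next
    case False
    then have b: "b = 0" using assms(2) M by simp
    then obtain x where x: "(a, d) \<in> diags" "x \<in> RZ_plus n R" "c = d * x"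
      using GZ_lower_factor assms(1) M by blast
    have "M ** \<gamma> = mat2 a 0 0 d ** (mat2 1 0 x 1 ** \<gamma>)"
      by (simp add: M b x(3) mat2_mult matrix_mul_assoc)
    then show ?thesis
      using is_form_unipotent(2)[OF x(2) assms(3)] is_form_diag[OF x(1)] by auto
  qed
qed

section \<open>\<open>EZ n R\<close> and \<open>W_grp n R\<close> as subgroups of the unit
  group\<close>

lemma G_simps [simp]:
  "carrier G = GZ n R" "M \<otimes>\<^bsub>G\<^esub> N = M ** N" "\<one>\<^bsub>G\<^esub> = mat 1"
  by (simp_all add: GZ_group_def)

lemma one_in_GZ: "mat 1 \<in> GZ n R"
  using unipotent_in_GZ(1)[OF RZ_plus_closed(1)] by (simp add: mat2_one)

sublocale GZ: monoid G
  by unfold_locales (simp_all add: GZ_mult one_in_GZ matrix_mul_assoc)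

abbreviation "triangulars \<equiv> {M \<in> GZ n R. M$2$1 = 0 \<or> M$1$2 = 0}"

text \<open>The inverse of diagonal times unipotent is the inverse unipotent times the inverse
  diagonal; written as such a product it visibly lies in \<open>GZ n R\<close>.\<close>

lemma triangular_inverse:
  assumes "M \<in> triangulars"
  obtains N where "N \<in> triangulars" "M ** N = mat 1" "N ** M = mat 1"
proof -
  obtain a b c d where M: "M = mat2 a b c d" by (rule mat2_cases)
  have MG: "M \<in> GZ n R" using assms by simp
  show ?thesis
  proof (cases "c = 0")
    case True
    then obtain x where x: "(a, d) \<in> diags" "x \<in> RZ_plus n R" "b = a * x"
      using GZ_upper_factor MG M by blast
    obtain a' d' where inv: "(a', d') \<in> diags" "a * a' = 1" "a' * a = 1" "d * d' = 1" "d' * d = 1"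
      using diags_inverse[OF x(1)] .
    have N: "mat2 1 (- x) 0 1 ** mat2 a' 0 0 d' = mat2 a' (- (x * d')) 0 d'"
      by (simp add: mat2_mult)
    have "mat2 a' (- (x * d')) 0 d' \<in> GZ n R"
      unfolding N[symmetric]
      using inv(1) unipotent_in_GZ(1) x(2) RZ_plus_closed(3) by (auto simp: diags_def intro: GZ_mult)
    moreover have "a' * (a * x) = x" "x * d' * d = x"
      using inv by (simp_all add: mult.assoc) (simp flip: mult.assoc)
    ultimately show ?thesis
      using that[of "mat2 a' (- (x * d')) 0 d'"] inv
      by (simp add: M True x(3) mat2_mult mat2_one mult.assoc)
  next
    case False
    then have b: "b = 0" using assms M by simp
    then obtain x where x: "(a, d) \<in> diags" "x \<in> RZ_plus n R" "c = d * x"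
      using GZ_lower_factor MG M by blast
    obtain a' d' where inv: "(a', d') \<in> diags" "a * a' = 1" "a' * a = 1" "d * d' = 1" "d' * d = 1"
      using diags_inverse[OF x(1)] .
    have N: "mat2 1 0 (- x) 1 ** mat2 a' 0 0 d' = mat2 a' 0 (- (x * a')) d'"
      by (simp add: mat2_mult)
    have "mat2 a' 0 (- (x * a')) d' \<in> GZ n R"
      unfolding N[symmetric]
      using inv(1) unipotent_in_GZ(2) x(2) RZ_plus_closed(3) by (auto simp: diags_def intro: GZ_mult)
    moreover have "d' * (d * x) = x" "x * a' * a = x"
      using inv by (simp_all add: mult.assoc) (simp flip: mult.assoc)
    ultimately show ?thesis
      using that[of "mat2 a' 0 (- (x * a')) d'"] inv
      by (simp add: M b x(3) mat2_mult mat2_one mult.assoc)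
  qed
qed

lemma triangular_inv_closed:
  assumes "M \<in> triangulars"
  shows "M \<in> Units G" "inv\<^bsub>G\<^esub> M \<in> triangulars"
proof -
  obtain N where N: "N \<in> triangulars" "M ** N = mat 1" "N ** M = mat 1"
    using triangular_inverse[OF assms] .
  show "M \<in> Units G"
    unfolding Units_def using N assms by auto
  have "inv\<^bsub>G\<^esub> M = N"
    using N assms by (intro GZ.inv_unique'[symmetric]) auto
  then show "inv\<^bsub>G\<^esub> M \<in> triangulars"
    using N(1) by simp
qed

text \<open>The first factor times \<open>W 0\<close> is \<open>W a\<close>, and the last three
  factors are the usual expression of \<open>W 0\<close> by elementary matrices.\<close>

lemma W_eq_unipotents:
  "W a = mat2 1 (- a) 0 1 ** (mat2 1 1 0 1 ** (mat2 1 0 (- 1) 1 ** mat2 1 1 0 1))"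
  by (simp add: W_def mat2_mult)

lemma W_in_EZ:
  assumes "a \<in> RZ_plus n R"
  shows "W a \<in> EZ n R"
proof -
  have U: "mat2 1 x 0 1 \<in> EZ n R" and L: "mat2 1 0 x 1 \<in> EZ n R" if "x \<in> RZ_plus n R" for x
    using unipotent_in_GZ that unfolding EZ_def by (auto intro!: generate.incl)
  have mult: "M ** N \<in> EZ n R" if "M \<in> EZ n R" "N \<in> EZ n R" for M N
    using generate.eng[of M G triangulars N] that unfolding EZ_def by simp
  show ?thesis
    unfolding W_eq_unipotents using assms RZ_plus_closed by (intro mult U L) auto
qed

sublocale U: group "units_of G"
  by (rule GZ.units_group)

lemma EZ_eq: "EZ n R = generate (units_of G) triangulars"
  unfolding EZ_def by (rule GZ.generate_units_of[symmetric]) (auto intro: triangular_inv_closed(1))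

lemma subgroup_EZ: "subgroup (EZ n R) (units_of G)"
  unfolding EZ_eq
  by (rule U.generate_is_subgroup) (auto simp: units_of_carrier intro: triangular_inv_closed(1))

text \<open>The letters \<open>W a\<close> are units because they lie in \<open>EZ n R\<close>, a
  subgroup of the unit group.\<close>

lemma W_grp_eq: "W_grp n R = generate (units_of G) (W ` RZ_plus n R)"
  unfolding W_grp_def
  using W_in_EZ subgroup.subset[OF subgroup_EZ]
  by (intro GZ.generate_units_of[symmetric]) (auto simp: units_of_carrier)

lemma EZ_group_eq: "EZ_group n R = (units_of G)\<lparr>carrier := EZ n R\<rparr>"
  by (simp add: EZ_group_def units_of_def GZ_group_def)

lemma subgroup_W_grp: "subgroup (W_grp n R) (EZ_group n R)"
  unfolding EZ_group_eq
proof (rule U.subgroup_incl)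
  have sub: "W ` RZ_plus n R \<subseteq> EZ n R"
    using W_in_EZ by blast
  show "subgroup (W_grp n R) (units_of G)"
    unfolding W_grp_eq using sub subgroup.subset[OF subgroup_EZ] by (intro U.generate_is_subgroup) auto
  show "W_grp n R \<subseteq> EZ n R"
    unfolding W_grp_eq by (rule U.generate_subgroup_incl[OF sub subgroup_EZ])
qed (rule subgroup_EZ)

section \<open>Existence and reduction of factorizations\<close>

lemma EZ_mult_is_form:
  assumes "M \<in> EZ n R" "is_form \<gamma> as"
  shows "\<exists>bs. is_form (M ** \<gamma>) bs"
  using assms unfolding EZ_def
\<comment> \<open>With the right factor arbitrary, the product case is a composition of two left
  multiplications.\<close>
proof (induction arbitrary: \<gamma> as)
  case one
  then show ?case by auto
next
  case (incl h)
  then show ?case using is_form_triangular by simp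
next
  case (inv h)
  then show ?case using is_form_triangular triangular_inv_closed(2)[of h] by blast
next
  case (eng h1 h2)
  obtain bs where "is_form (h2 ** \<gamma>) bs" using eng.IH(2)[OF eng.prems] by blast
  from eng.IH(1)[OF this] show ?case by (simp add: matrix_mul_assoc)
qed

lemma EZ_is_form:
  assumes "M \<in> EZ n R"
  obtains as where "is_form M as"
  using EZ_mult_is_form[OF assms is_form_one] by auto

text \<open>\<open>a\<close> and \<open>b\<close> are the neighbours that the relation changes while
  removing the inner letter \<open>c\<close>; the new letters stay in
  \<open>RZ_plus n R\<close>.\<close>

lemma is_form_shorten:
  assumes "is_form \<gamma> (xs @ a # c # b # ys)" "c \<in> {0, 1, - 1}"
  shows "\<exists>bs. is_form \<gamma> bs \<and> length bs < length (xs @ a # c # b # ys)"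
proof -
  obtain u v where uv: "(u, v) \<in> diags" "\<gamma> = W_word (xs @ a # c # b # ys) (mat2 u 0 0 v)"
    using assms(1) unfolding is_form_def by blast
  have set: "set xs \<subseteq> RZ_plus n R" "a \<in> RZ_plus n R" "b \<in> RZ_plus n R" "set ys \<subseteq> RZ_plus n R"
    using assms(1) unfolding is_form_def by auto
  have \<gamma>: "\<gamma> = W_word xs (W a ** (W c ** (W b ** W_word ys (mat2 u 0 0 v))))"
    by (simp add: uv(2) W_word_append)
  \<comment> \<open>The signs in the relations for 0 and -1 are absorbed by the diagonal matrix,
    whose entries may both be negated.\<close>
  have neg: "mat2 (- u) 0 0 (- v) = - mat2 u 0 0 v"
    by (simp add: mat2_uminus)
  consider "c = 0" | "c = 1" | "c = - 1"
    using assms(2) by blast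
  then show ?thesis
  proof cases
    case 1
    then have "\<gamma> = W_word (xs @ (a + b) # ys) (mat2 (- u) 0 0 (- v))"
      by (simp add: \<gamma> W_zero_reduce W_word_append neg W_word_uminus matrix_mult_uminus_right)
    then have "is_form \<gamma> (xs @ (a + b) # ys)"
      unfolding is_form_def using diags_uminus[OF uv(1)] set RZ_plus_closed by auto
    then show ?thesis by (intro exI conjI) auto
  next
    case 2
    then have "\<gamma> = W_word (xs @ (a - 1) # (b - 1) # ys) (mat2 u 0 0 v)"
      by (simp add: \<gamma> W_one_reduce W_word_append)
    then have "is_form \<gamma> (xs @ (a - 1) # (b - 1) # ys)"
      unfolding is_form_def using uv(1) set RZ_plus_closed by auto
    then show ?thesis by (intro exI conjI) auto
  next
    case 3
    then have "\<gamma> = W_word (xs @ (a + 1) # (b + 1) # ys) (mat2 (- u) 0 0 (- v))"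
      by (simp add: \<gamma> W_minus_one_reduce W_word_append neg W_word_uminus matrix_mult_uminus_right)
    then have "is_form \<gamma> (xs @ (a + 1) # (b + 1) # ys)"
      unfolding is_form_def using diags_uminus[OF uv(1)] set RZ_plus_closed by auto
    then show ?thesis by (intro exI conjI) auto
  qed
qed

lemma EZ_reduced_form:
  assumes "\<gamma> \<in> EZ n R"
  obtains as where "is_form \<gamma> as" "\<And>i. 0 < i \<Longrightarrow> i < length as - 1 \<Longrightarrow> as ! i \<notin> {0, 1, - 1}"
proof -
  define as where "as = (ARG_MIN length as. is_form \<gamma> as)"
  have as: "is_form \<gamma> as" and min: "\<And>bs. is_form \<gamma> bs \<Longrightarrow> length as \<le> length bs"
    using EZ_is_form[OF assms] arg_min_nat_lemma[of "is_form \<gamma>" _ length] unfolding as_def by blast+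
  moreover have "as ! i \<notin> {0, 1, - 1}" if i: "0 < i" "i < length as - 1" for i
  proof
    assume c: "as ! i \<in> {0, 1, - 1}"
    \<comment> \<open>\<open>0 < i\<close> provides the left neighbour at \<open>j\<close>, and
      \<open>i < length as - 1\<close> the right one at \<open>Suc (Suc j)\<close>.\<close>
    obtain j where j: "i = Suc j" using i(1) by (cases i) auto
    have "as = take j as @ as ! j # as ! Suc j # as ! Suc (Suc j) # drop (Suc (Suc (Suc j))) as"
      using i(2) unfolding j
      by (metis Cons_nth_drop_Suc Suc_lessD append_take_drop_id less_diff_conv plus_1_eq_Suc add.commute)
    then show False
      using is_form_shorten[of \<gamma> "take j as" "as ! j" "as ! Suc j"] as min c j
      by (metis not_less)
  qed
  ultimately show ?thesis using that by blast
qed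

text \<open>A factorization places every element in the right coset of its diagonal factor, so there
  are at most as many cosets as elements of \<open>diags\<close>.\<close>

lemma finite_rcosets_W_grp: "finite (rcosets\<^bsub>EZ_group n R\<^esub> (W_grp n R))"
proof -
  interpret E: group "EZ_group n R"
    unfolding EZ_group_eq by (rule U.subgroup_imp_group[OF subgroup_EZ])
  interpret S: subgroup "W_grp n R" "EZ_group n R"
    by (rule subgroup_W_grp)
  have carrier: "carrier (EZ_group n R) = EZ n R" and mult: "x \<otimes>\<^bsub>EZ_group n R\<^esub> y = x ** y" for x y
    by (simp_all add: EZ_group_def GZ_group_def)
  have word: "W_word as (mat 1) \<in> W_grp n R" if "set as \<subseteq> RZ_plus n R" for as
    using that
  proof (induction as)
    case Nil
    then show ?case using generate.one[of G] by (simp add: W_grp_def)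
  next
    case (Cons a as)
    then have "W a \<in> W_grp n R" "W_word as (mat 1) \<in> W_grp n R"
      unfolding W_grp_def by (auto intro: generate.incl)
    then show ?case using S.m_closed by (simp add: mult)
  qed
  have "rcosets\<^bsub>EZ_group n R\<^esub> (W_grp n R) \<subseteq>
          (\<lambda>(u, v). W_grp n R #>\<^bsub>EZ_group n R\<^esub> mat2 u 0 0 v) ` diags"
  proof
    fix C assume "C \<in> rcosets\<^bsub>EZ_group n R\<^esub> (W_grp n R)"
    then obtain \<gamma> where \<gamma>: "\<gamma> \<in> EZ n R" "C = W_grp n R #>\<^bsub>EZ_group n R\<^esub> \<gamma>"
      unfolding RCOSETS_def carrier by blast
    obtain as where "is_form \<gamma> as" using EZ_is_form[OF \<gamma>(1)] .
    then obtain u v where uv: "set as \<subseteq> RZ_plus n R" "(u, v) \<in> diags" "\<gamma> = W_word as (mat2 u 0 0 v)"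
      unfolding is_form_def by blast
    define w where "w = W_word as (mat 1)"
    have w: "w \<in> W_grp n R" "w \<in> EZ n R"
      using word[OF uv(1)] S.subset unfolding w_def carrier by auto
    have D: "mat2 u 0 0 v \<in> EZ n R"
      using uv(2) unfolding EZ_def diags_def by (auto intro!: generate.incl)
    have "\<gamma> = w \<otimes>\<^bsub>EZ_group n R\<^esub> mat2 u 0 0 v"
      by (simp add: mult w_def uv(3) W_word_mult)
    \<comment> \<open>The word stands to the left of the diagonal matrix, so a right coset of
      \<open>W_grp n R\<close> swallows it.\<close>
    then have "C = (W_grp n R #>\<^bsub>EZ_group n R\<^esub> w) #>\<^bsub>EZ_group n R\<^esub> mat2 u 0 0 v"
      using E.coset_mult_assoc[OF S.subset] w(2) D \<gamma>(2) unfolding carrier by simp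
    also have "W_grp n R #>\<^bsub>EZ_group n R\<^esub> w = W_grp n R"
      using S.rcos_const[OF E.group_axioms w(1)] .
    finally show "C \<in> (\<lambda>(u, v). W_grp n R #>\<^bsub>EZ_group n R\<^esub> mat2 u 0 0 v) ` diags"
      using uv(2) by (intro image_eqI[of _ _ "(u, v)"]) auto
  qed
  then show ?thesis
    using finite_diags finite_subset by blast
qed

end

theorem theorem4p3:
  fixes n :: nat and R :: "quat set"
  assumes "n \<in> {3, 4, 5}" and "is_RZ n R"
  shows "(\<forall>\<gamma> \<in> EZ n R. \<exists>as \<omega> \<omega>'.
            as \<noteq> [] \<and> set as \<subseteq> RZ_plus n R \<and>
            (\<forall>i. 0 < i \<and> i < length as - 1 \<longrightarrow> as ! i \<notin> {0, 1, - 1}) \<and>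
            mat2 \<omega> 0 0 \<omega>' \<in> GZ n R \<and>
            \<gamma> = foldr (\<lambda>a M. W a ** M) as (mat2 \<omega> 0 0 \<omega>'))
         \<and> subgroup (W_grp n R) (EZ_group n R)
         \<and> finite (rcosets\<^bsub>EZ_group n R\<^esub> (W_grp n R))"
proof -
  interpret arithmetic_ring R n
    using is_RZ_arithmetic_ring[OF assms] .
  show ?thesis
  proof (intro conjI ballI subgroup_W_grp finite_rcosets_W_grp)
    fix \<gamma> assume "\<gamma> \<in> EZ n R"
    then obtain as where as: "is_form \<gamma> as"
        "\<And>i. 0 < i \<Longrightarrow> i < length as - 1 \<Longrightarrow> as ! i \<notin> {0, 1, - 1}"
      using EZ_reduced_form by blast
    then obtain u v where "(u, v) \<in> diags" "\<gamma> = W_word as (mat2 u 0 0 v)"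
      unfolding is_form_def by blast
    with as show "\<exists>as \<omega> \<omega>'. as \<noteq> [] \<and> set as \<subseteq> RZ_plus n R \<and>
        (\<forall>i. 0 < i \<and> i < length as - 1 \<longrightarrow> as ! i \<notin> {0, 1, - 1}) \<and>
        mat2 \<omega> 0 0 \<omega>' \<in> GZ n R \<and> \<gamma> = foldr (\<lambda>a M. W a ** M) as (mat2 \<omega> 0 0 \<omega>')"
      unfolding is_form_def diags_def W_word_def
      by (intro exI[of _ as] exI[of _ u] exI[of _ v]) auto
  qed
qed

end
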